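(* Let $(\mathsf X,\mathcal B)$ be a measurable space and let $\mathcal P$ (null) and $\mathcal Q$ (alternative) be nonempty sets of probability measures on $(\mathsf X,\mathcal B)$. The following statements are equivalent. (i) For some $\alpha\in(0,1)$, there exists a level-$\alpha$ sequential test for $\mathcal P$ with power one against every $Q\in\mathcal Q$. (ii) For every $\alpha\in(0,1)$, there exists a level-$\alpha$ sequential test for $\mathcal P$ with power one against every $Q\in\mathcal Q$. (iii) There exists an e-process $(\mathcal E_n)_{n\ge0}$ for $\mathcal P$ such that $\mathcal E_n\to\infty$ $Q^\infty$-almost surely for every $Q\in\mathcal Q$. (iii$'$) There exists an e-process $(\mathcal E_n)_{n\ge0}$ for $\mathcal P$ such that $\limsup_{n\to\infty}\mathcal E_n=\infty$ $Q^\infty$-almost surely for every $Q\in\mathcal Q$. (iv) There exists a countable family $(n_m,B_m)_{m\ge1}$, with $n_m\ge1$ and $B_m\in\mathcal B^{\otimes n_m}$, such that for every $Q\in\mathcal Q$ there is an $m$ with $Q^{n_m}(B_m)>\sup_{P\in\mathcal P}P^{n_m}(B_m)$. (v) There exists a countable family $(n_m,\varphi_m)_{m\ge1}$ with $n_m\ge 1$ and $\varphi_m:\mathsf X^{n_m}\to[0,1]$ measurable, such that for every $Q\in\mathcal Q$ there is an $m$ with $\mathbb E_{Q^{n_m}}\varphi_m>\sup_{P\in\mathcal P}\mathbb E_{P^{n_m}}\varphi_m$. Equivalently, there is a countable family $(n_m,\varphi_m,q_m)_{m\ge1}$ with such $n_m,\varphi_m$ and $q_m\in\mathbb Q\cap[0,1]$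 (here $\mathbb Q$ denotes the rationals) such that for every $Q\in\mathcal Q$ there is an $m$ with $\sup_{P\in\mathcal P}\mathbb E_{P^{n_m}}\varphi_m\le q_m<\mathbb E_{Q^{n_m}}\varphi_m$. (vi) There exists a countable family $(n_m,h_m)_{m\ge1}$ of bounded measurable functions $h_m:\mathsf X^{n_m}\to\mathbb R$, $n_m\ge1$, such that $\sup_{P\in\mathcal P}\mathbb E_{P^{n_m}}h_m\le0$ for every $m$, and for every $Q\in\mathcal Q$ there is an $m$ with $\mathbb E_{Q^{n_m}}h_m>0$. (vii) There exists a countable family $(F_m)_{m\ge1}$ of bounded estimable law functionals of finite degrees such that $F_m(P)\le0$ for every $P\in\mathcal P$ and every $m$, and every $Q\in\mathcal Q$ satisfies $F_m(Q)>0$ for at least one $m$. (viii) There exist deterministic nondecreasing integers $0=t_0\le t_1\le t_2\le\cdots$ with $t_k\le k$ for all $k$ and $t_k/k\to1$, and a nonnegative process $(S_k)_{k\ge0}$ adapted to the filtration $(\mathcal F_{t_k})_{k\ge0}$, such that $S_0=1$; for every $P\in\mathcal P$ the process $(S_k)$ is integrable and a supermartingale under $P^\infty$ with respect to $(\mathcal F_{t_k})$; and $S_k\to\infty$ $Q^\infty$-almost surely for every $Q\in\mathcal Q$.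
   Context: For a probability measure $R$ on $(\mathsf X,\mathcal B)$, $R^n$ and $R^\infty$ denote the i.i.d. product laws on $\mathsf X^n$ and $\mathsf X^{\mathbb N}$ with product sigma-algebras. $(X_i)_{i\ge1}$ is the coordinate process on $\mathsf X^{\mathbb N}$, $\mathcal F_n=\sigma(X_1,\dots,X_n)$ for $n\ge1$, and $\mathcal F_0$ is trivial. A sequential test is a stopping time $\tau:\mathsf X^{\mathbb N}\to\{1,2,\dots\}\cup\{\infty\}$ with respect to $(\mathcal F_n)$. It is level-$\alpha$ for $\mathcal P$ if $\sup_{P\in\mathcal P}P^\infty(\tau<\infty)\le\alpha$, and has power one against $Q$ if $Q^\infty(\tau<\infty)=1$. An e-process for $\mathcal P$ is an $(\mathcal F_n)$-adapted process $(\mathcal E_n)_{n\ge0}$ with values in $[0,\infty]$ such that $\mathbb E_{P^\infty}\mathcal E_\tau\le1$ for every $P\in\mathcal P$ and every $(\mathcal F_n)_{n\ge 0}$-stopping time $\tau$ with values in $\{0,1,\dots\}\cup\{\infty\}$, where $\mathcal E_\infty:=\liminf_{n\to\infty}\mathcal E_n$ (it is not required that $\mathcal E_0=1$). A functional $F$ from the set of all probability measures on $(\mathsf X,\mathcal B)$ to $\mathbb R$ is bounded estimable of degree at most $n$ if $F(R)=\mathbb E_{R^n}h$ for all $R$, for some bounded measurable symmetric $h:\mathsf X^n\to\mathbb R$. *)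

theory Defs
  imports "HOL-Probability.Probability"
begin

text \<open>
  The measurable space is carried by a measure \<open>M\<close>, of which only \<open>space M\<close> and \<open>sets M\<close> are used;
  the set of all probability measures on it is \<open>space (prob_algebra M)\<close>. Both abbreviations below are
  used for a probability measure (giving the i.i.d. product law) and for \<open>M\<close> itself (giving the
  product measurable space). Coordinates are numbered from 0, so that \<open>X\<^sub>i\<close> is \<open>\<lambda>\<omega>. \<omega> (i - 1)\<close>.
\<close>

abbreviation pow_measure :: "'a measure \<Rightarrow> nat \<Rightarrow> (nat \<Rightarrow> 'a) measure" where
  "pow_measure R n \<equiv> Pi\<^sub>M {..<n} (\<lambda>_. R)"

abbreviation seq_measure :: "'a measure \<Rightarrow> (nat \<Rightarrow> 'a) measure" where
  "seq_measure R \<equiv> Pi\<^sub>M (UNIV :: nat set) (\<lambda>_. R)"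

text \<open>
  The index type is \<^typ>\<open>enat\<close> so that the library's \<^const>\<open>stopping_time\<close> applies to times that may
  be infinite. The condition it imposes at index \<open>\<infinity>\<close> is void, as \<open>\<tau> \<omega> \<le> \<infinity>\<close> always holds.
\<close>

definition nat_filtration :: "'a measure \<Rightarrow> enat \<Rightarrow> (nat \<Rightarrow> 'a) measure" where
  "nat_filtration M t = sigma (space (seq_measure M))
     {(\<lambda>\<omega>. \<omega> i) -` A \<inter> space (seq_measure M) | i A. enat i < t \<and> A \<in> sets M}"

definition sequential_test :: "'a measure \<Rightarrow> ((nat \<Rightarrow> 'a) \<Rightarrow> enat) \<Rightarrow> bool" where
  "sequential_test M \<tau> \<longleftrightarrow>
     stopping_time (nat_filtration M) \<tau> \<and> (\<forall>\<omega>\<in>space (seq_measure M). 1 \<le> \<tau> \<omega>)"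

definition stop_prob :: "'a measure \<Rightarrow> ((nat \<Rightarrow> 'a) \<Rightarrow> enat) \<Rightarrow> real" where
  "stop_prob R \<tau> = measure (seq_measure R) {\<omega> \<in> space (seq_measure R). \<tau> \<omega> < \<infinity>}"

definition level :: "real \<Rightarrow> 'a measure set \<Rightarrow> ((nat \<Rightarrow> 'a) \<Rightarrow> enat) \<Rightarrow> bool" where
  "level \<alpha> \<P> \<tau> \<longleftrightarrow> (SUP P\<in>\<P>. stop_prob P \<tau>) \<le> \<alpha>"

definition power_one :: "'a measure \<Rightarrow> ((nat \<Rightarrow> 'a) \<Rightarrow> enat) \<Rightarrow> bool" where
  "power_one Q \<tau> \<longleftrightarrow> stop_prob Q \<tau> = 1"

definition stopped :: "(nat \<Rightarrow> 'b \<Rightarrow> ennreal) \<Rightarrow> ('b \<Rightarrow> enat) \<Rightarrow> 'b \<Rightarrow> ennreal" where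
  "stopped E \<tau> \<omega> = (case \<tau> \<omega> of enat n \<Rightarrow> E n \<omega> | \<infinity> \<Rightarrow> liminf (\<lambda>n. E n \<omega>))"

definition e_process ::
    "'a measure \<Rightarrow> 'a measure set \<Rightarrow> (nat \<Rightarrow> (nat \<Rightarrow> 'a) \<Rightarrow> ennreal) \<Rightarrow> bool" where
  "e_process M \<P> E \<longleftrightarrow>
     (\<forall>n. E n \<in> borel_measurable (nat_filtration M (enat n))) \<and>
     (\<forall>P\<in>\<P>. \<forall>\<tau>. stopping_time (nat_filtration M) \<tau> \<longrightarrow>
        (\<integral>\<^sup>+\<omega>. stopped E \<tau> \<omega> \<partial>seq_measure P) \<le> 1)"

definition supermartingale ::
    "'b measure \<Rightarrow> (nat \<Rightarrow> 'b measure) \<Rightarrow> (nat \<Rightarrow> 'b \<Rightarrow> real) \<Rightarrow> bool" where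
  "supermartingale N G S \<longleftrightarrow>
     (\<forall>k. subalgebra N (G k)) \<and> (\<forall>j k. j \<le> k \<longrightarrow> subalgebra (G k) (G j)) \<and>
     (\<forall>k. S k \<in> borel_measurable (G k)) \<and> (\<forall>k. integrable N (S k)) \<and>
     (\<forall>j k. j \<le> k \<longrightarrow> (AE \<omega> in N. real_cond_exp N (G j) (S k) \<omega> \<le> S j \<omega>))"

definition bounded_measurable :: "'b measure \<Rightarrow> ('b \<Rightarrow> real) \<Rightarrow> bool" where
  "bounded_measurable N h \<longleftrightarrow> h \<in> borel_measurable N \<and> bounded (h ` space N)"

definition symmetric_fun :: "'a measure \<Rightarrow> nat \<Rightarrow> ((nat \<Rightarrow> 'a) \<Rightarrow> real) \<Rightarrow> bool" where
  "symmetric_fun M n h \<longleftrightarrow>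
     (\<forall>\<pi>. \<pi> permutes {..<n} \<longrightarrow> (\<forall>x\<in>space (pow_measure M n). h (x \<circ> \<pi>) = h x))"

text \<open>Only the values of \<open>F\<close> on \<open>space (prob_algebra M)\<close> matter; \<open>n\<close> bounds the degree.\<close>

definition bounded_estimable :: "'a measure \<Rightarrow> nat \<Rightarrow> ('a measure \<Rightarrow> real) \<Rightarrow> bool" where
  "bounded_estimable M n F \<longleftrightarrow>
     (\<exists>h. bounded_measurable (pow_measure M n) h \<and> symmetric_fun M n h \<and>
          (\<forall>R\<in>space (prob_algebra M). F R = (\<integral>x. h x \<partial>pow_measure R n)))"

definition all_equivalent :: "bool list \<Rightarrow> bool" where
  "all_equivalent ps \<longleftrightarrow> (\<forall>p\<in>set ps. \<forall>q\<in>set ps. p \<longleftrightarrow> q)"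

end

theory Submission
  imports Defs "HOL-Library.Discrete_Functions"
begin

text \<open>
  The implications (iii') \<open>\<Longrightarrow>\<close> (ii) (Markov's inequality at the first crossing of \<open>1/\<alpha>\<close>) and
  (ii) \<open>\<Longrightarrow>\<close> (iii) (the e-process counts which of countably many tests, of levels \<open>2\<^sup>-\<^sup>j\<close>, have
  rejected so far) are direct, (i) \<open>\<Longrightarrow>\<close> (iv) uses the events \<open>\<tau> \<le> m\<close>, and (iv)--(vii) differ only by
  affine transformations and symmetrization. From (viii) one gets (ii) by Ville's inequality.

  For (vii) \<open>\<Longrightarrow>\<close> (viii), cut time into the epochs \<open>[r\<^sup>2, (r+1)\<^sup>2)\<close> and let a gambler with a
  statistic \<open>h\<close> of \<open>n\<close> variables bet once per epoch, on its first \<open>n\<close> observations, with the factor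
  \<open>1 + b h\<close>. Looked at only at the ends of epochs, the wealth is a nonnegative supermartingale under
  the null. If \<open>E\<^sub>Q h > 0\<close> and \<open>b\<close> is small, then \<open>E\<^sub>Q (1 + b h)\<^sup>-\<^sup>1 < 1\<close>, so the reciprocal of the wealth
  has a summable sequence of \<open>Q\<close>-expectations, and the wealth diverges almost surely without any
  recourse to the law of large numbers. Mixing over all statistics and \<open>b = 1/2, 1/3, \<dots>\<close> yields one
  process for all alternatives; since epochs have length \<open>o(r\<^sup>2)\<close>, the times \<open>t\<^sub>k = \<lfloor>\<surd>k\<rfloor>\<^sup>2\<close> satisfy
  \<open>t\<^sub>k / k \<longrightarrow> 1\<close>.
\<close>

section \<open>I.i.d. laws and the coordinate filtration\<close>

lemma prob_algebraD:
  assumes "R \<in> space (prob_algebra M)"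
  shows "prob_space R" "sets R = sets M" "space R = space M"
  using assms by (auto simp: space_prob_algebra dest: sets_eq_imp_space_eq)

lemma prob_space_iid:
  assumes "R \<in> space (prob_algebra M)"
  shows "prob_space (Pi\<^sub>M I (\<lambda>_. R))"
  using assms by (intro prob_space_PiM) (auto simp: space_prob_algebra)

lemma sets_iid:
  assumes "R \<in> space (prob_algebra M)"
  shows "sets (Pi\<^sub>M I (\<lambda>_. R)) = sets (Pi\<^sub>M I (\<lambda>_. M))"
    and "space (Pi\<^sub>M I (\<lambda>_. R)) = space (Pi\<^sub>M I (\<lambda>_. M))"
proof -
  show "sets (Pi\<^sub>M I (\<lambda>_. R)) = sets (Pi\<^sub>M I (\<lambda>_. M))"
    using prob_algebraD(2)[OF assms] by (intro sets_PiM_cong) auto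
  then show "space (Pi\<^sub>M I (\<lambda>_. R)) = space (Pi\<^sub>M I (\<lambda>_. M))"
    by (rule sets_eq_imp_space_eq)
qed

lemma measurable_iid:
  assumes "R \<in> space (prob_algebra M)"
  shows "measurable (Pi\<^sub>M I (\<lambda>_. R)) N = measurable (Pi\<^sub>M I (\<lambda>_. M)) N"
  by (intro measurable_cong_sets sets_iid[OF assms] refl)

lemma integrable_bounded_iid:
  assumes "R \<in> space (prob_algebra M)" "bounded_measurable (Pi\<^sub>M I (\<lambda>_. M)) h"
  shows "integrable (Pi\<^sub>M I (\<lambda>_. R)) (h :: _ \<Rightarrow> real)"
proof -
  interpret prob_space "Pi\<^sub>M I (\<lambda>_. R)" by (rule prob_space_iid[OF assms(1)])
  obtain c where "\<And>x. x \<in> space (Pi\<^sub>M I (\<lambda>_. M)) \<Longrightarrow> norm (h x) \<le> c"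
    using assms(2) unfolding bounded_measurable_def bounded_iff by blast
  then show ?thesis
    using assms by (intro integrable_const_bound[where B=c])
      (auto simp: sets_iid[OF assms(1)] measurable_iid[OF assms(1)] bounded_measurable_def intro!: AE_I2)
qed

section \<open>Sigma-algebras of the coordinate filtration\<close>

lemma space_nat_filtration [simp]: "space (nat_filtration M t) = space (seq_measure M)"
  unfolding nat_filtration_def by (intro space_measure_of) auto

lemma sets_nat_filtration:
  "sets (nat_filtration M t) = sigma_sets (space (seq_measure M))
     {(\<lambda>\<omega>. \<omega> i) -` A \<inter> space (seq_measure M) | i A. enat i < t \<and> A \<in> sets M}"
  unfolding nat_filtration_def by (intro sets_measure_of) auto

lemma measurable_nat_filtration_component:
  assumes "enat i < t"
  shows "(\<lambda>\<omega>. \<omega> i) \<in> nat_filtration M t \<rightarrow>\<^sub>M M"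
proof (rule measurableI)
  show "\<omega> i \<in> space M" if "\<omega> \<in> space (nat_filtration M t)" for \<omega>
    using that by (auto simp: space_PiM)
  show "(\<lambda>\<omega>. \<omega> i) -` A \<inter> space (nat_filtration M t) \<in> sets (nat_filtration M t)"
    if "A \<in> sets M" for A
    using that assms unfolding space_nat_filtration sets_nat_filtration by (intro sigma_sets.Basic) auto
qed

lemma measurable_nat_filtration_block:
  assumes "T + n \<le> t"
  shows "(\<lambda>\<omega>. \<lambda>i\<in>{..<n}. \<omega> (T + i)) \<in> nat_filtration M (enat t) \<rightarrow>\<^sub>M pow_measure M n"
  using assms by (intro measurable_restrict measurable_nat_filtration_component) auto

lemma sets_nat_filtration_mono:
  assumes "s \<le> t"
  shows "sets (nat_filtration M s) \<subseteq> sets (nat_filtration M t)"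
  unfolding sets_nat_filtration using assms by (intro sigma_sets_mono') (auto intro: less_le_trans)

lemma sets_nat_filtration_subset:
  "sets (nat_filtration M t) \<subseteq> sets (seq_measure M)"
  unfolding sets_nat_filtration
  by (intro sets.sigma_sets_subset) (auto intro!: measurable_sets[OF measurable_component_singleton])

lemma sets_nat_filtration_iid:
  assumes "R \<in> space (prob_algebra M)"
  shows "sets (nat_filtration M t) \<subseteq> sets (seq_measure R)"
  using sets_nat_filtration_subset sets_iid(1)[OF assms] by fast

lemma subalgebra_nat_filtration_iid:
  assumes "R \<in> space (prob_algebra M)"
  shows "subalgebra (seq_measure R) (nat_filtration M t)"
  using sets_nat_filtration_iid[OF assms] sets_iid(2)[OF assms] by (auto simp: subalgebra_def)

lemma subalgebra_nat_filtration_mono: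
  "s \<le> t \<Longrightarrow> subalgebra (nat_filtration M t) (nat_filtration M s)"
  using sets_nat_filtration_mono by (auto simp: subalgebra_def)

lemma measurable_nat_filtration_iid:
  assumes "R \<in> space (prob_algebra M)" "f \<in> nat_filtration M s \<rightarrow>\<^sub>M N"
  shows "f \<in> seq_measure R \<rightarrow>\<^sub>M N"
  using measurable_from_subalg[OF subalgebra_nat_filtration_iid] assms by blast

text \<open>The preimages under restriction to the first \<open>n\<close> coordinates form a
  sigma-algebra that contains the generators. This is what later turns stopping events into events
  of a fixed sample size.\<close>

lemma sets_nat_filtrationE:
  assumes "A \<in> sets (nat_filtration M (enat n))"
  obtains B where "B \<in> sets (pow_measure M n)"
    "A = (\<lambda>\<omega>. restrict \<omega> {..<n}) -` B \<inter> space (seq_measure M)"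
proof -
  define r where "r = (\<lambda>\<omega> :: nat \<Rightarrow> 'a. restrict \<omega> {..<n})"
  have r: "r \<omega> \<in> space (pow_measure M n)" if "\<omega> \<in> space (seq_measure M)" for \<omega>
    using that by (auto simp: r_def space_PiM PiE_iff extensional_def)
  have r_component: "r \<omega> i = \<omega> i" if "i < n" for \<omega> i
    using that by (simp add: r_def)
  have "\<exists>B\<in>sets (pow_measure M n). A = r -` B \<inter> space (seq_measure M)"
    using assms unfolding sets_nat_filtration
  proof (induction rule: sigma_sets.induct)
    case (Basic a)
    then obtain i A where iA: "i < n" "A \<in> sets M" "a = (\<lambda>\<omega>. \<omega> i) -` A \<inter> space (seq_measure M)" by auto
    then show ?case using r
      by (intro bexI[of _ "(\<lambda>x. x i) -` A \<inter> space (pow_measure M n)"])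
        (auto simp: r_component intro!: measurable_sets[OF measurable_component_singleton])
  next
    case Empty then show ?case by (intro bexI[of _ "{}"]) auto
  next
    case (Compl a)
    then obtain B where "B \<in> sets (pow_measure M n)" "a = r -` B \<inter> space (seq_measure M)" by blast
    then show ?case using r
      by (intro bexI[of _ "space (pow_measure M n) - B"]) auto
  next
    case (Union a)
    then have "\<forall>i. \<exists>B. B \<in> sets (pow_measure M n) \<and> a i = r -` B \<inter> space (seq_measure M)" by blast
    from choice[OF this] obtain B
      where "\<forall>i. B i \<in> sets (pow_measure M n) \<and> a i = r -` B i \<inter> space (seq_measure M)" ..
    then show ?case by (intro bexI[of _ "\<Union>i. B i"]) auto
  qed
  with that show ?thesis by (auto simp: r_def)
qed

text \<open>A pointwise Doob-Dynkin principle: the fibre of \<open>f\<close> through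
  \<open>\<omega>\<close> is a cylinder over the first \<open>n\<close> coordinates, so it contains
  \<open>\<omega>'\<close> as well. The sort \<open>t1_space\<close> makes singletons Borel.\<close>

lemma measurable_nat_filtration_cong:
  assumes f: "f \<in> borel_measurable (nat_filtration M (enat n))"
    and "\<omega> \<in> space (seq_measure M)" "\<omega>' \<in> space (seq_measure M)" "\<And>i. i < n \<Longrightarrow> \<omega> i = \<omega>' i"
  shows "(f \<omega> :: 'b :: t1_space) = f \<omega>'"
proof -
  have "f -` {f \<omega>} \<inter> space (seq_measure M) \<in> sets (nat_filtration M (enat n))"
    using measurable_sets[OF f, of "{f \<omega>}"] by simp
  then obtain B where B: "f -` {f \<omega>} \<inter> space (seq_measure M) = (\<lambda>\<omega>. restrict \<omega> {..<n}) -` B \<inter> space (seq_measure M)"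
    by (rule sets_nat_filtrationE)
  have "restrict \<omega> {..<n} = restrict \<omega>' {..<n}"
    using assms(4) by (auto simp: restrict_def)
  moreover have "\<omega> \<in> f -` {f \<omega>} \<inter> space (seq_measure M)" using assms(2) by simp
  ultimately have "\<omega>' \<in> f -` {f \<omega>} \<inter> space (seq_measure M)" using B assms(3) by auto
  then show ?thesis by simp
qed

lemma distr_restrict_iid:
  assumes "R \<in> space (prob_algebra M)"
  shows "distr (seq_measure R) (pow_measure R n) (\<lambda>\<omega>. restrict \<omega> {..<n}) = pow_measure R n"
proof -
  interpret prob_space R using prob_algebraD[OF assms] by simp
  interpret product_prob_space "\<lambda>_::nat. R" UNIV by unfold_locales
  show ?thesis by (rule distr_PiM_restrict_finite) auto
qed

text \<open>Independence of past and future by splicing: two independent i.i.d. sequences joined at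
  time \<open>T\<close> again have the i.i.d. law. After the splice \<open>f\<close> reads only the
  first sequence and \<open>g\<close> only the second, and Tonelli separates the two. Nonnegative
  integrals keep the identity free of integrability conditions.\<close>

lemma nn_integral_past_times_block:
  assumes R: "R \<in> space (prob_algebra M)"
    and f: "f \<in> borel_measurable (nat_filtration M (enat T))"
    and g: "g \<in> borel_measurable (pow_measure M n)"
  shows "(\<integral>\<^sup>+\<omega>. f \<omega> * g (\<lambda>i\<in>{..<n}. \<omega> (T + i)) \<partial>seq_measure R)
       = (\<integral>\<^sup>+\<omega>. f \<omega> \<partial>seq_measure R) * (\<integral>\<^sup>+x. g x \<partial>pow_measure R n)"
proof -
  interpret R: prob_space R using prob_algebraD[OF R] by simp
  interpret sequence_space R by unfold_locales
  have f'[measurable]: "f \<in> borel_measurable S" using measurable_nat_filtration_iid[OF R f] .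
  have g'[measurable]: "g \<in> borel_measurable (pow_measure R n)" using g measurable_iid[OF R] by blast
  have [measurable]: "(\<lambda>\<omega>. \<lambda>i\<in>{..<n}. \<omega> (T + i)) \<in> S \<rightarrow>\<^sub>M pow_measure R n"
    by (intro measurable_restrict measurable_component_singleton) auto
  have [measurable]: "(\<lambda>\<omega>. restrict \<omega> {..<n}) \<in> S \<rightarrow>\<^sub>M pow_measure R n"
    by (intro measurable_restrict measurable_component_singleton) auto
  have c[measurable]: "(\<lambda>(\<omega>, \<omega>'). comb_seq T \<omega> \<omega>') \<in> S \<Otimes>\<^sub>M S \<rightarrow>\<^sub>M S" by (rule measurable_comb_seq)
  have "(\<integral>\<^sup>+\<omega>. f \<omega> * g (\<lambda>i\<in>{..<n}. \<omega> (T + i)) \<partial>S)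
     = (\<integral>\<^sup>+\<omega>. f \<omega> * g (\<lambda>i\<in>{..<n}. \<omega> (T + i)) \<partial>distr (S \<Otimes>\<^sub>M S) S (\<lambda>(\<omega>, \<omega>'). comb_seq T \<omega> \<omega>'))"
    by (simp only: PiM_comb_seq)
  also have "\<dots> = (\<integral>\<^sup>+p. (\<lambda>(\<omega>, \<omega>'). f (comb_seq T \<omega> \<omega>') * g (\<lambda>i\<in>{..<n}. comb_seq T \<omega> \<omega>' (T + i))) p \<partial>(S \<Otimes>\<^sub>M S))"
    by (subst nn_integral_distr) (auto simp: case_prod_unfold)
  also have "\<dots> = (\<integral>\<^sup>+p. (\<lambda>(\<omega>, \<omega>'). f \<omega> * g (restrict \<omega>' {..<n})) p \<partial>(S \<Otimes>\<^sub>M S))"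
  proof (intro nn_integral_cong)
    fix p assume p: "p \<in> space (S \<Otimes>\<^sub>M S)"
    then have "comb_seq T (fst p) (snd p) \<in> space S"
      using measurable_space[OF c p] by (simp add: case_prod_unfold)
    \<comment> \<open>\<open>f\<close> depends only on coordinates below \<open>T\<close>, where the
      splice agrees with its first sequence.\<close>
    then have "f (comb_seq T (fst p) (snd p)) = f (fst p)"
      using p sets_iid(2)[OF R] by (intro measurable_nat_filtration_cong[OF f])
        (auto simp: comb_seq_less space_pair_measure)
    moreover have "comb_seq T (fst p) (snd p) (T + i) = snd p i" for i
      by (simp add: comb_seq_def)
    ultimately show "(case p of (\<omega>, \<omega>') \<Rightarrow> f (comb_seq T \<omega> \<omega>') * g (\<lambda>i\<in>{..<n}. comb_seq T \<omega> \<omega>' (T + i)))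
        = (case p of (\<omega>, \<omega>') \<Rightarrow> f \<omega> * g (restrict \<omega>' {..<n}))"
      by (simp add: case_prod_unfold restrict_def cong: if_cong)
  qed
  also have "\<dots> = (\<integral>\<^sup>+\<omega>. \<integral>\<^sup>+\<omega>'. f \<omega> * g (restrict \<omega>' {..<n}) \<partial>S \<partial>S)"
    by (subst P.nn_integral_fst[symmetric]) auto
  also have "\<dots> = (\<integral>\<^sup>+\<omega>. f \<omega> \<partial>S) * (\<integral>\<^sup>+\<omega>'. g (restrict \<omega>' {..<n}) \<partial>S)"
    by (simp add: nn_integral_cmult nn_integral_multc)
  also have "(\<integral>\<^sup>+\<omega>'. g (restrict \<omega>' {..<n}) \<partial>S) = (\<integral>\<^sup>+x. g x \<partial>distr S (pow_measure R n) (\<lambda>\<omega>. restrict \<omega> {..<n}))"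
    by (subst nn_integral_distr) auto
  finally show ?thesis by (simp only: distr_restrict_iid[OF R])
qed

section \<open>Sequential tests and e-processes\<close>

text \<open>Index \<open>0\<close> is skipped because a sequential test takes values at least
  \<open>1\<close>.\<close>

definition hitting_time :: "(nat \<Rightarrow> 'b set) \<Rightarrow> 'b \<Rightarrow> enat" where
  "hitting_time A \<omega> =
     (if \<exists>n\<ge>1. \<omega> \<in> A n then enat (LEAST n. 1 \<le> n \<and> \<omega> \<in> A n) else \<infinity>)"

lemma hitting_time_le_iff:
  "hitting_time A \<omega> \<le> enat t \<longleftrightarrow> (\<exists>n\<ge>1. n \<le> t \<and> \<omega> \<in> A n)"
proof (cases "\<exists>n\<ge>1. \<omega> \<in> A n")
  case True
  let ?L = "LEAST n. 1 \<le> n \<and> \<omega> \<in> A n"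
  have L: "1 \<le> ?L \<and> \<omega> \<in> A ?L" using True by (rule LeastI_ex)
  have le: "?L \<le> n" if "1 \<le> n" "\<omega> \<in> A n" for n using conjI[OF that] by (rule Least_le)
  have "hitting_time A \<omega> = enat ?L" using True by (simp only: hitting_time_def if_True)
  then have "hitting_time A \<omega> \<le> enat t \<longleftrightarrow> ?L \<le> t" by simp
  also have "\<dots> \<longleftrightarrow> (\<exists>n\<ge>1. n \<le> t \<and> \<omega> \<in> A n)"
    using L le order_trans by blast
  finally show ?thesis .
next
  case False
  then have "hitting_time A \<omega> = \<infinity>" by (simp only: hitting_time_def if_False)
  with False show ?thesis by auto
qed

lemma hitting_time_finite_iff:
  "hitting_time A \<omega> < \<infinity> \<longleftrightarrow> (\<exists>n\<ge>1. \<omega> \<in> A n)"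
proof
  assume "hitting_time A \<omega> < \<infinity>"
  then obtain t where "hitting_time A \<omega> = enat t" by auto
  then show "\<exists>n\<ge>1. \<omega> \<in> A n" using hitting_time_le_iff[of A \<omega> t] by auto
next
  assume "\<exists>n\<ge>1. \<omega> \<in> A n"
  then obtain n where "1 \<le> n" "\<omega> \<in> A n" by blast
  then have "hitting_time A \<omega> \<le> enat n" unfolding hitting_time_le_iff by blast
  also have "\<dots> < \<infinity>" by simp
  finally show "hitting_time A \<omega> < \<infinity>" .
qed

lemma hitting_time_mem:
  assumes "hitting_time A \<omega> = enat n"
  shows "\<omega> \<in> A n"
proof -
  obtain k where k: "1 \<le> k" "k \<le> n" "\<omega> \<in> A k"
    using hitting_time_le_iff[of A \<omega> n] assms by auto
  then have "hitting_time A \<omega> \<le> enat k" unfolding hitting_time_le_iff by blast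
  with k assms show ?thesis by auto
qed

lemma sequential_test_hitting_time:
  assumes "\<And>n. A n \<in> sets (nat_filtration M (enat n))"
  shows "sequential_test M (hitting_time A)"
  unfolding sequential_test_def stopping_time_def
proof (intro conjI allI ballI)
  fix t show "Measurable.pred (nat_filtration M t) (\<lambda>\<omega>. hitting_time A \<omega> \<le> t)"
  proof (cases t)
    case (enat n)
    have "{\<omega>\<in>space (nat_filtration M t). hitting_time A \<omega> \<le> t}
        = (\<Union>k\<in>{1..n}. A k)"
      using sets.sets_into_space[OF assms] by (force simp: enat hitting_time_le_iff)
    also have "\<dots> \<in> sets (nat_filtration M t)"
      using assms sets_nat_filtration_mono[of "enat _" t M] by (intro sets.finite_UN) (auto simp: enat)
    finally show ?thesis by (simp add: pred_def)
  qed simp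
next
  fix \<omega> show "1 \<le> hitting_time A \<omega>"
    using hitting_time_le_iff[of A \<omega> 0] by (cases "hitting_time A \<omega>") (auto simp: one_enat_def)
qed

lemma sequential_test_le_sets:
  assumes "sequential_test M \<tau>"
  shows "{\<omega>\<in>space (seq_measure M). \<tau> \<omega> \<le> enat n} \<in> sets (nat_filtration M (enat n))"
  using assms unfolding sequential_test_def stopping_time_def pred_def by (auto dest: spec[of _ "enat n"])

lemma finite_enat_iff_le: "x < \<infinity> \<longleftrightarrow> (\<exists>n. x \<le> enat n)"
  by (cases x) auto

lemma sequential_test_finite_sets:
  assumes "sequential_test M \<tau>"
  shows "{\<omega>\<in>space (seq_measure M). \<tau> \<omega> < \<infinity>} \<in> sets (seq_measure M)"
proof -
  have "{\<omega>\<in>space (seq_measure M). \<tau> \<omega> < \<infinity>} = (\<Union>n. {\<omega>\<in>space (seq_measure M). \<tau> \<omega> \<le> enat n})"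
    unfolding finite_enat_iff_le by blast
  also have "\<dots> \<in> sets (seq_measure M)"
    using sequential_test_le_sets[OF assms] sets_nat_filtration_subset by (intro sets.countable_UN) blast
  finally show ?thesis .
qed

text \<open>A real supremum bounds its members only if the family is bounded above; here all members
  are probabilities.\<close>

lemma stop_prob_le_level:
  assumes "\<P> \<subseteq> space (prob_algebra M)" "level \<alpha> \<P> \<tau>" "P \<in> \<P>"
  shows "stop_prob P \<tau> \<le> \<alpha>"
proof -
  have "stop_prob R \<tau> \<le> 1" if "R \<in> \<P>" for R
    unfolding stop_prob_def using that assms(1)
    by (intro prob_space.prob_le_1 prob_space_iid[of R M]) auto
  then have "bdd_above ((\<lambda>P. stop_prob P \<tau>) ` \<P>)" by (intro bdd_aboveI2)
  then show ?thesis using assms(2,3) cSUP_upper[of P \<P> "\<lambda>P. stop_prob P \<tau>"]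
    unfolding level_def by linarith
qed

lemma power_one_AE:
  assumes Q: "Q \<in> space (prob_algebra M)" and "sequential_test M \<tau>"
  shows "power_one Q \<tau> \<longleftrightarrow> (AE \<omega> in seq_measure Q. \<tau> \<omega> < \<infinity>)"
proof -
  interpret prob_space "seq_measure Q" by (rule prob_space_iid[OF Q])
  have "{\<omega>\<in>space (seq_measure Q). \<tau> \<omega> < \<infinity>} \<in> events"
    using sequential_test_finite_sets[OF assms(2)] by (simp only: sets_iid[OF Q])
  then show ?thesis
    unfolding power_one_def stop_prob_def by (rule prob_Collect_eq_1)
qed

text \<open>The common body of (i) and (ii), which differ only in the quantifier over
  \<open>\<alpha>\<close>. Folding it lets the implications be proved one level at a time.\<close>

definition testable :: "'a measure \<Rightarrow> 'a measure set \<Rightarrow> 'a measure set \<Rightarrow> real \<Rightarrow> bool" where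
  "testable M \<P> \<Q> \<alpha> \<longleftrightarrow> (\<exists>\<tau>. sequential_test M \<tau> \<and> level \<alpha> \<P> \<tau> \<and> (\<forall>Q\<in>\<Q>. power_one Q \<tau>))"

lemma testable_hitting_time:
  assumes "\<P> \<noteq> {}" "\<Q> \<subseteq> space (prob_algebra M)"
    and A: "\<And>n. A n \<in> sets (nat_filtration M (enat n))"
    and P: "\<And>P. P \<in> \<P> \<Longrightarrow> stop_prob P (hitting_time A) \<le> \<alpha>"
    and Q: "\<And>Q. Q \<in> \<Q> \<Longrightarrow> AE \<omega> in seq_measure Q. \<exists>n\<ge>1. \<omega> \<in> A n"
  shows "testable M \<P> \<Q> \<alpha>"
  unfolding testable_def
proof (intro exI conjI ballI)
  show st: "sequential_test M (hitting_time A)" by (rule sequential_test_hitting_time[OF A])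
  show "level \<alpha> \<P> (hitting_time A)"
    unfolding level_def using assms(1) P by (rule cSUP_least)
  show "power_one Q (hitting_time A)" if "Q \<in> \<Q>" for Q
    using power_one_AE[OF _ st] Q[OF that] assms(2) that unfolding hitting_time_finite_iff by blast
qed

text \<open>The number of tests that ever reject is one random variable dominating
  \<open>E n\<close> for all \<open>n\<close> at once, and its null expectation is at most the sum
  of the levels. It therefore also dominates \<open>E\<close> stopped at any time. Under an
  alternative every test eventually rejects, so the count grows without bound.\<close>

lemma testable_imp_e_process:
  assumes \<P>: "\<P> \<subseteq> space (prob_algebra M)" and \<Q>: "\<Q> \<subseteq> space (prob_algebra M)"
    and test: "\<And>\<alpha>. \<alpha> \<in> {0<..<1} \<Longrightarrow> testable M \<P> \<Q> \<alpha>"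
  shows "\<exists>E. e_process M \<P> E \<and> (\<forall>Q\<in>\<Q>. AE \<omega> in seq_measure Q. (\<lambda>n. E n \<omega>) \<longlonglongrightarrow> \<infinity>)"
proof -
  \<comment> \<open>The exponent \<open>Suc j\<close> keeps the first level below one and makes the
    levels sum to exactly one, the budget of an e-process.\<close>
  have "\<exists>\<tau>. sequential_test M \<tau> \<and> level ((1/2) ^ Suc j) \<P> \<tau> \<and> (\<forall>Q\<in>\<Q>. power_one Q \<tau>)" for j
    using test[of "(1/2) ^ Suc j"] unfolding testable_def by (auto simp: power_less_one_iff simp del: power_Suc)
  then obtain \<tau> where st: "\<And>j. sequential_test M (\<tau> j)" and lv: "\<And>j. level ((1/2) ^ Suc j) \<P> (\<tau> j)"
    and po: "\<And>j Q. Q \<in> \<Q> \<Longrightarrow> power_one Q (\<tau> j)" by metis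
  define E :: "nat \<Rightarrow> (nat \<Rightarrow> 'a) \<Rightarrow> ennreal" where
    "E n \<omega> = (\<Sum>j. indicator {\<omega>\<in>space (seq_measure M). \<tau> j \<omega> \<le> enat n} \<omega>)" for n \<omega>
  define F :: "nat \<Rightarrow> (nat \<Rightarrow> 'a) set" where
    "F j = {\<omega>\<in>space (seq_measure M). \<tau> j \<omega> < \<infinity>}" for j
  have E_le: "E n \<omega> \<le> (\<Sum>j. indicator (F j) \<omega>)" for n \<omega>
    unfolding E_def F_def finite_enat_iff_le by (intro suminf_le summableI) (auto simp: indicator_def)
  have "e_process M \<P> E"
    unfolding e_process_def
  proof (intro conjI allI ballI impI)
    show "E n \<in> borel_measurable (nat_filtration M (enat n))" for n
      unfolding E_def using sequential_test_le_sets[OF st]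
      by (intro borel_measurable_suminf_order borel_measurable_indicator)
  next
    fix P \<sigma> assume "P \<in> \<P>"
    then have P: "P \<in> space (prob_algebra M)" using \<P> by blast
    interpret prob_space "seq_measure P" by (rule prob_space_iid[OF P])
    have F: "F j \<in> events" for j
      unfolding F_def using sequential_test_finite_sets[OF st] by (simp only: sets_iid[OF P])
    \<comment> \<open>Where \<open>\<sigma>\<close> is infinite the stopped value is a liminf, which
      inherits the bound because it is uniform in \<open>n\<close>.\<close>
    have "stopped E \<sigma> \<omega> \<le> (\<Sum>j. indicator (F j) \<omega>)" for \<omega>
      unfolding stopped_def using E_le
      by (auto split: enat.split intro!: Liminf_le[OF _ always_eventually, THEN order_trans] order_refl
          simp: Liminf_const)
    then have "(\<integral>\<^sup>+\<omega>. stopped E \<sigma> \<omega> \<partial>seq_measure P) \<le> (\<integral>\<^sup>+\<omega>. (\<Sum>j. indicator (F j) \<omega>) \<partial>seq_measure P)"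
      by (intro nn_integral_mono)
    also have "\<dots> = (\<Sum>j. emeasure (seq_measure P) (F j))"
      using F by (subst nn_integral_suminf) auto
    also have "\<dots> \<le> (\<Sum>j. ennreal ((1/2) ^ Suc j))"
    proof (intro suminf_le summableI)
      show "emeasure (seq_measure P) (F j) \<le> ennreal ((1/2) ^ Suc j)" for j
        using stop_prob_le_level[OF \<P> lv \<open>P \<in> \<P>\<close>, of j]
        unfolding emeasure_eq_measure stop_prob_def F_def by (intro ennreal_leI) (simp only: sets_iid[OF P])
    qed
    also have "\<dots> = ennreal (\<Sum>j. (1/2) ^ Suc j)"
      by (intro suminf_ennreal2 sums_summable[OF power_half_series]) simp
    also have "\<dots> = 1" using sums_unique[OF power_half_series] by simp
    finally show "(\<integral>\<^sup>+\<omega>. stopped E \<sigma> \<omega> \<partial>seq_measure P) \<le> 1" .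
  qed
  moreover have "AE \<omega> in seq_measure Q. (\<lambda>n. E n \<omega>) \<longlonglongrightarrow> \<infinity>" if "Q \<in> \<Q>" for Q
  proof -
    have Q: "Q \<in> space (prob_algebra M)" using \<Q> that by blast
    have "AE \<omega> in seq_measure Q. \<forall>j. \<tau> j \<omega> < \<infinity>"
      using power_one_AE[OF Q st] po[OF that] by (simp add: AE_all_countable)
    then show ?thesis
    proof (rule AE_mp, intro AE_I2 impI)
      fix \<omega> assume "\<omega> \<in> space (seq_measure Q)" and fin: "\<forall>j. \<tau> j \<omega> < \<infinity>"
      then have \<omega>: "\<omega> \<in> space (seq_measure M)" by (simp only: sets_iid[OF Q])
      obtain N where N: "\<And>j. \<tau> j \<omega> \<le> enat (N j)" using fin unfolding finite_enat_iff_le by metis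
      \<comment> \<open>Once \<open>n\<close> has passed the bounds \<open>N j\<close> of the first
        \<open>K\<close> tests, at least \<open>K\<close> of the indicators equal one.\<close>
      have ge: "of_nat K \<le> E n \<omega>" if "n \<ge> Max (N ` {..K})" for n K
      proof -
        have "\<tau> j \<omega> \<le> enat n" if "j < K" for j
        proof -
          have "N j \<le> Max (N ` {..K})" using that by (intro Max_ge) auto
          then show ?thesis using N[of j] \<open>n \<ge> _\<close> by (meson enat_ord_simps(1) order_trans)
        qed
        then have "of_nat K = (\<Sum>j<K. indicator {\<omega>\<in>space (seq_measure M). \<tau> j \<omega> \<le> enat n} \<omega> :: ennreal)"
          using \<omega> by (simp add: indicator_def)
        also have "\<dots> \<le> E n \<omega>" unfolding E_def by (intro sum_le_suminf summableI) auto
        finally show ?thesis .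
      qed
      show "(\<lambda>n. E n \<omega>) \<longlonglongrightarrow> \<infinity>"
        unfolding tendsto_PInfty_eq_at_top[where 'a=nat] infinity_ennreal_def
      proof (rule order_tendstoI)
        fix a :: ennreal assume "a < top"
        then obtain K :: nat where "a < of_nat K" using ennreal_Ex_less_of_nat by auto
        then show "\<forall>\<^sub>F n in sequentially. a < E n \<omega>"
          using ge[of K] by (intro eventually_sequentiallyI) (rule less_le_trans)
      qed auto
    qed
  qed
  ultimately show ?thesis by blast
qed

lemma e_process_imp_testable:
  assumes \<P>: "\<P> \<subseteq> space (prob_algebra M)" "\<P> \<noteq> {}" and \<Q>: "\<Q> \<subseteq> space (prob_algebra M)"
    and E: "e_process M \<P> E"
    and lim: "\<And>Q. Q \<in> \<Q> \<Longrightarrow> AE \<omega> in seq_measure Q. limsup (\<lambda>n. E n \<omega>) = \<infinity>"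
    and \<alpha>: "0 < \<alpha>"
  shows "testable M \<P> \<Q> \<alpha>"
proof (rule testable_hitting_time)
  define c where "c = ennreal (1 / \<alpha>)"
  define A where "A n = {\<omega>\<in>space (nat_filtration M (enat n)). c \<le> E n \<omega>}" for n
  show A: "A n \<in> sets (nat_filtration M (enat n))" for n
  proof -
    have [measurable]: "E n \<in> borel_measurable (nat_filtration M (enat n))"
      using E by (simp add: e_process_def)
    show ?thesis unfolding A_def by measurable
  qed
  show "stop_prob P (hitting_time A) \<le> \<alpha>" if "P \<in> \<P>" for P
  proof -
    have P: "P \<in> space (prob_algebra M)" using \<P> that by blast
    interpret prob_space "seq_measure P" by (rule prob_space_iid[OF P])
    let ?\<tau> = "hitting_time A"
    let ?F = "{\<omega>\<in>space (seq_measure P). ?\<tau> \<omega> < \<infinity>}"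
    have st: "sequential_test M ?\<tau>" by (rule sequential_test_hitting_time[OF A])
    have F: "?F \<in> events" using sequential_test_finite_sets[OF st] by (simp only: sets_iid[OF P])
    \<comment> \<open>At a finite hitting time the stopped value is at least \<open>c\<close>. Where
      the level is never reached the left side is zero, so any value of the liminf will do.\<close>
    have "c * indicator ?F \<omega> \<le> stopped E ?\<tau> \<omega>" for \<omega>
      unfolding stopped_def
      by (cases "?\<tau> \<omega>") (auto simp: indicator_def A_def dest!: hitting_time_mem)
    then have "(\<integral>\<^sup>+\<omega>. c * indicator ?F \<omega> \<partial>seq_measure P) \<le> (\<integral>\<^sup>+\<omega>. stopped E ?\<tau> \<omega> \<partial>seq_measure P)"
      by (intro nn_integral_mono)
    also have "\<dots> \<le> 1" using E st that by (auto simp: e_process_def sequential_test_def)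
    finally have "c * emeasure (seq_measure P) ?F \<le> 1"
      using F by (simp add: nn_integral_cmult_indicator)
    then have "ennreal (1 / \<alpha> * prob ?F) \<le> ennreal 1"
      unfolding c_def emeasure_eq_measure using \<alpha> by (subst ennreal_mult) auto
    then show ?thesis using \<alpha> by (simp add: stop_prob_def field_simps)
  qed
  show "AE \<omega> in seq_measure Q. \<exists>n\<ge>1. \<omega> \<in> A n" if "Q \<in> \<Q>" for Q
    using lim[OF that]
  proof (rule AE_mp, intro AE_I2 impI)
    fix \<omega> assume \<omega>: "\<omega> \<in> space (seq_measure Q)" and l: "limsup (\<lambda>n. E n \<omega>) = \<infinity>"
    have "Q \<in> space (prob_algebra M)" using \<Q> that by blast
    then have \<omega>': "\<omega> \<in> space (seq_measure M)" using \<omega> by (simp only: sets_iid)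
    show "\<exists>n\<ge>1. \<omega> \<in> A n"
    proof (rule ccontr)
      assume none: "\<not> ?thesis"
      have "E n \<omega> \<le> c" if "1 \<le> n" for n
        proof -
        have "\<omega> \<notin> A n" using that none by blast
        then show ?thesis using \<omega>' by (simp add: A_def)
      qed
      \<comment> \<open>The limsup ignores index \<open>0\<close>, which the hitting time does not
        inspect.\<close>
      then have "limsup (\<lambda>n. E n \<omega>) \<le> c"
        by (intro Limsup_bounded eventually_sequentiallyI[of 1]) auto
      with l show False by (simp add: c_def top_unique)
    qed
  qed
qed (use assms in auto)

text \<open>The events \<open>\<tau> \<le> m\<close> increase to
  \<open>\<tau> < \<infinity>\<close>, so by continuity from below their probabilities under an
  alternative tend to one and pass \<open>\<alpha>\<close>, while under the null they never exceed
  it. The family of events is common to all alternatives; only the index depends on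
  \<open>Q\<close>.\<close>

lemma testable_imp_event_separation:
  assumes \<P>: "\<P> \<subseteq> space (prob_algebra M)" "\<P> \<noteq> {}" and \<Q>: "\<Q> \<subseteq> space (prob_algebra M)"
    and "testable M \<P> \<Q> \<alpha>" and \<alpha>: "\<alpha> < 1"
  shows "\<exists>(n :: nat \<Rightarrow> nat) B.
         (\<forall>m. 1 \<le> n m \<and> B m \<in> sets (pow_measure M (n m))) \<and>
         (\<forall>Q\<in>\<Q>. \<exists>m. measure (pow_measure Q (n m)) (B m) >
                      (SUP P\<in>\<P>. measure (pow_measure P (n m)) (B m)))"
proof -
  obtain \<tau> where st: "sequential_test M \<tau>" and lv: "level \<alpha> \<P> \<tau>" and po: "\<And>Q. Q \<in> \<Q> \<Longrightarrow> power_one Q \<tau>"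
    using assms unfolding testable_def by blast
  \<comment> \<open>The shift to \<open>Suc m\<close> keeps every sample size at least one.\<close>
  define A where "A m = {\<omega>\<in>space (seq_measure M). \<tau> \<omega> \<le> enat (Suc m)}" for m
  have A: "A m \<in> sets (nat_filtration M (enat (Suc m)))" for m
    unfolding A_def by (rule sequential_test_le_sets[OF st])
  have "\<forall>m. \<exists>B. B \<in> sets (pow_measure M (Suc m)) \<and>
      A m = (\<lambda>\<omega>. restrict \<omega> {..<Suc m}) -` B \<inter> space (seq_measure M)"
  proof
    fix m show "\<exists>B. B \<in> sets (pow_measure M (Suc m)) \<and>
      A m = (\<lambda>\<omega>. restrict \<omega> {..<Suc m}) -` B \<inter> space (seq_measure M)"
      by (rule sets_nat_filtrationE[OF A[of m]]) blast
  qed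
  from choice[OF this]
  obtain B where B: "\<And>m. B m \<in> sets (pow_measure M (Suc m))"
    and AB: "\<And>m. A m = (\<lambda>\<omega>. restrict \<omega> {..<Suc m}) -` B m \<inter> space (seq_measure M)" by blast
  have meas: "measure (pow_measure R (Suc m)) (B m) = measure (seq_measure R) (A m)"
    if R: "R \<in> space (prob_algebra M)" for R m
  proof -
    have r: "(\<lambda>\<omega>. restrict \<omega> {..<Suc m}) \<in> seq_measure R \<rightarrow>\<^sub>M pow_measure R (Suc m)"
      by (intro measurable_restrict measurable_component_singleton) auto
    have "B m \<in> sets (pow_measure R (Suc m))" using B by (simp only: sets_iid[OF R])
    from measure_distr[OF r this] show ?thesis
      unfolding AB distr_restrict_iid[OF R] sets_iid(2)[OF R] .
  qed
  show ?thesis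
  proof (intro exI[of _ Suc] exI[of _ B] conjI allI ballI)
    fix Q assume "Q \<in> \<Q>"
    then have Q: "Q \<in> space (prob_algebra M)" using \<Q> by blast
    interpret Q: prob_space "seq_measure Q" by (rule prob_space_iid[OF Q])
    have "(\<lambda>m. measure (seq_measure Q) (A m)) \<longlonglongrightarrow> measure (seq_measure Q) (\<Union>m. A m)"
      using A sets_nat_filtration_iid[OF Q]
      by (intro Q.finite_Lim_measure_incseq) (auto simp: A_def incseq_def intro: order_trans)
    also have "(\<Union>m. A m) = {\<omega>\<in>space (seq_measure Q). \<tau> \<omega> < \<infinity>}"
      unfolding A_def finite_enat_iff_le sets_iid(2)[OF Q]
      by (fastforce intro: order_trans[of "\<tau> _" "enat k" "enat (Suc k)" for k])
    also have "measure (seq_measure Q) \<dots> = 1"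
      using po[OF \<open>Q \<in> \<Q>\<close>] by (simp add: power_one_def stop_prob_def)
    finally have "eventually (\<lambda>m. \<alpha> < measure (seq_measure Q) (A m)) sequentially"
      using \<alpha> by (rule order_tendstoD)
    then obtain m where m: "\<alpha> < measure (seq_measure Q) (A m)"
      using eventually_happens trivial_limit_sequentially by blast
    have "measure (seq_measure P) (A m) \<le> \<alpha>" if "P \<in> \<P>" for P
    proof -
      have P: "P \<in> space (prob_algebra M)" using \<P> that by blast
      interpret P: prob_space "seq_measure P" by (rule prob_space_iid[OF P])
      have "measure (seq_measure P) (A m) \<le> stop_prob P \<tau>"
        unfolding stop_prob_def using sequential_test_finite_sets[OF st]
        unfolding A_def finite_enat_iff_le sets_iid(2)[OF P]
        by (intro P.finite_measure_mono) (auto simp: sets_iid[OF P])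
      then show ?thesis using stop_prob_le_level[OF \<P>(1) lv that] by simp
    qed
    then have "(SUP P\<in>\<P>. measure (pow_measure P (Suc m)) (B m)) \<le> \<alpha>"
      using \<P> meas by (intro cSUP_least) auto
    then show "\<exists>m. measure (pow_measure Q (Suc m)) (B m) > (SUP P\<in>\<P>. measure (pow_measure P (Suc m)) (B m))"
      using m meas[OF Q] by (intro exI[of _ m]) simp
  qed (simp_all add: B)
qed

section \<open>Supermartingales and Ville's inequality\<close>

text \<open>The hypothesis is applied to the set where the conditional expectation exceeds
  \<open>g\<close>. The excess is nonnegative there but has nonpositive integral, hence vanishes
  almost everywhere.\<close>

lemma (in sigma_finite_subalgebra) real_cond_exp_le:
  assumes f: "integrable M f" and g: "integrable M g" and gF[measurable]: "g \<in> borel_measurable F"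
    and le: "\<And>A. A \<in> sets F \<Longrightarrow> (\<integral>x\<in>A. f x \<partial>M) \<le> (\<integral>x\<in>A. g x \<partial>M)"
  shows "AE x in M. real_cond_exp M F f x \<le> g x"
proof -
  let ?c = "real_cond_exp M F f"
  define A where "A = {x\<in>space F. g x < ?c x}"
  have AF: "A \<in> sets F" unfolding A_def by measurable
  then have AM: "A \<in> sets M" using subalg by (auto simp: subalgebra_def)
  have int: "integrable M (\<lambda>x. indicator A x * ?c x)" "integrable M (\<lambda>x. indicator A x * g x)"
    using integrable_mult_indicator[OF AM real_cond_exp_int(1)[OF f]]
      integrable_mult_indicator[OF AM g] by simp_all
  have "(\<integral>x. indicator A x * ?c x - indicator A x * g x \<partial>M) = (\<integral>x\<in>A. ?c x \<partial>M) - (\<integral>x\<in>A. g x \<partial>M)"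
    using int by (simp add: set_lebesgue_integral_def)
  also have "\<dots> = (\<integral>x\<in>A. f x \<partial>M) - (\<integral>x\<in>A. g x \<partial>M)"
    using real_cond_exp_intA[OF f AF] by simp
  also have "\<dots> \<le> 0" using le[OF AF] by simp
  finally have le0: "(\<integral>x. indicator A x * ?c x - indicator A x * g x \<partial>M) \<le> 0" .
  have nn: "0 \<le> indicator A x * ?c x - indicator A x * g x" for x
    by (auto simp: A_def indicator_def)
  have "(\<integral>x. indicator A x * ?c x - indicator A x * g x \<partial>M) = 0"
    using le0 nn by (intro antisym integral_nonneg) auto
  then have "AE x in M. indicator A x * ?c x - indicator A x * g x = 0"
    using int nn by (subst (asm) integral_nonneg_eq_0_iff_AE) auto
  then show ?thesis
  proof (rule AE_mp, intro AE_I2 impI)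
    fix x assume "x \<in> space M" "indicator A x * ?c x - indicator A x * g x = 0"
    then show "?c x \<le> g x"
      using subalg by (cases "x \<in> A") (auto simp: A_def subalgebra_def)
  qed
qed

lemma supermartingale_set_integral_le:
  assumes "finite_measure N" "supermartingale N G S" and A: "A \<in> sets (G j)" and "j \<le> k"
  shows "(\<integral>x\<in>A. S k x \<partial>N) \<le> (\<integral>x\<in>A. S j x \<partial>N)"
proof -
  have sub: "subalgebra N (G j)" and int: "integrable N (S k)" "integrable N (S j)"
    and ae: "AE x in N. real_cond_exp N (G j) (S k) x \<le> S j x"
    using assms by (auto simp: supermartingale_def)
  interpret finite_measure_subalgebra N "G j"
    using assms(1) sub by (simp add: finite_measure_subalgebra_def finite_measure_subalgebra_axioms_def)
  have AN: "A \<in> sets N" using A sub by (auto simp: subalgebra_def)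
  have "(\<integral>x\<in>A. S k x \<partial>N) = (\<integral>x\<in>A. real_cond_exp N (G j) (S k) x \<partial>N)"
    using int A by (intro real_cond_exp_intA)
  also have "\<dots> \<le> (\<integral>x\<in>A. S j x \<partial>N)"
    unfolding set_lebesgue_integral_def
  proof (intro integral_mono_AE integrable_mult_indicator[OF AN] real_cond_exp_int(1) int)
    show "AE x in N. indicator A x *\<^sub>R real_cond_exp N (G j) (S k) x \<le> indicator A x *\<^sub>R S j x"
      using ae by eventually_elim (simp add: indicator_def)
  qed
  finally show ?thesis .
qed

text \<open>Trades conditional expectations for integrals over past events, which independence of
  the past and the next block makes computable.\<close>

lemma supermartingaleI:
  assumes "finite_measure N"
    and sub: "\<And>k. subalgebra N (G k)" "\<And>j k. j \<le> k \<Longrightarrow> subalgebra (G k) (G j)"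
    and S: "\<And>k. S k \<in> borel_measurable (G k)" "\<And>k. integrable N (S k)"
    and le: "\<And>j k A. j \<le> k \<Longrightarrow> A \<in> sets (G j) \<Longrightarrow> (\<integral>x\<in>A. S k x \<partial>N) \<le> (\<integral>x\<in>A. S j x \<partial>N)"
  shows "supermartingale N G S"
  unfolding supermartingale_def
proof (intro conjI allI impI)
  fix j k :: nat assume "j \<le> k"
  interpret finite_measure_subalgebra N "G j"
    using assms(1) sub(1) by (simp add: finite_measure_subalgebra_def finite_measure_subalgebra_axioms_def)
  show "AE x in N. real_cond_exp N (G j) (S k) x \<le> S j x"
    using S le[OF \<open>j \<le> k\<close>] by (intro real_cond_exp_le) auto
qed (use sub S in auto)

text \<open>The process is frozen at value \<open>c\<close> once it has reached \<open>c\<close>.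
  The quantity \<open>c * measure N (U k)\<close> plus the integral of \<open>S k\<close> off
  \<open>U k\<close> is then nonincreasing in \<open>k\<close> and starts at the mean of
  \<open>S 0\<close>; dropping the nonnegative second term and letting \<open>k\<close> grow gives
  the bound.\<close>

lemma Ville_inequality:
  assumes fin: "finite_measure N" and sm: "supermartingale N G S"
    and nn: "\<And>k \<omega>. \<omega> \<in> space N \<Longrightarrow> 0 \<le> S k \<omega>" and c: "0 < c"
  shows "c * measure N {\<omega>\<in>space N. \<exists>k. c \<le> S k \<omega>} \<le> (\<integral>\<omega>. S 0 \<omega> \<partial>N)"
proof -
  interpret finite_measure N by fact
  have sub: "subalgebra N (G k)" and int: "integrable N (S k)" and ms: "S k \<in> borel_measurable (G k)" for k
    using sm by (auto simp: supermartingale_def)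
  have sp: "space (G k) = space N" and sets_le: "sets (G k) \<subseteq> sets N" for k
    using sub[of k] by (auto simp: subalgebra_def)
  have mono: "sets (G j) \<subseteq> sets (G k)" if "j \<le> k" for j k
    using sm that by (auto simp: supermartingale_def subalgebra_def)
  \<comment> \<open>The strict \<open>j < k\<close> makes \<open>U 0\<close> empty and
    \<open>U (Suc k)\<close> an event of \<open>G k\<close>, so the step from \<open>k\<close> to
    \<open>Suc k\<close> may be taken on its complement.\<close>
  define U where "U k = {\<omega>\<in>space N. \<exists>j<k. c \<le> S j \<omega>}" for k
  have U_G: "U (Suc k) \<in> sets (G k)" for k
  proof -
    have "{\<omega>\<in>space (G j). c \<le> S j \<omega>} \<in> sets (G k)" if "j \<le> k" for j
      using borel_measurable_le[OF borel_measurable_const ms[of j]] mono[OF that] by blast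
    then have "(\<Union>j\<in>{..k}. {\<omega>\<in>space (G j). c \<le> S j \<omega>}) \<in> sets (G k)"
      by (intro sets.finite_UN) auto
    also have "(\<Union>j\<in>{..k}. {\<omega>\<in>space (G j). c \<le> S j \<omega>}) = U (Suc k)"
      by (auto simp: U_def sp less_Suc_eq_le)
    finally show ?thesis .
  qed
  have U_N: "U k \<in> sets N" for k
  proof (cases k)
    case (Suc j)
    then show ?thesis using U_G[of j] sets_le[of j] by blast
  qed (simp add: U_def)
  have intB: "integrable N (\<lambda>x. indicator (space N - U i) x * S j x)" for i j
    using integrable_mult_indicator[OF sets.compl_sets[OF U_N] int] by simp
  have intU: "integrable N (\<lambda>x. c * indicator (U i) x)" for i
    using U_N by (auto simp: integrable_indicator_iff less_top[symmetric])
  have val: "(\<integral>x. c * indicator (U i) x + indicator (space N - U i) x * S j x \<partial>N)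
      = c * measure N (U i) + (\<integral>x\<in>space N - U i. S j x \<partial>N)" for i j
    using intU intB U_N sets.sets_into_space[OF U_N, of i]
    by (simp add: set_lebesgue_integral_def Int_absorb2)
  have main: "c * measure N (U k) + (\<integral>x\<in>space N - U k. S k x \<partial>N) \<le> (\<integral>\<omega>. S 0 \<omega> \<partial>N)" for k
  proof (induction k)
    case 0
    have "(\<integral>x\<in>space N. S 0 x \<partial>N) = (\<integral>x. S 0 x \<partial>N)"
      using int by (rule set_integral_space)
    then show ?case by (simp add: U_def)
  next
    case (Suc k)
    have "c * measure N (U (Suc k)) + (\<integral>x\<in>space N - U (Suc k). S (Suc k) x \<partial>N)
        \<le> c * measure N (U (Suc k)) + (\<integral>x\<in>space N - U (Suc k). S k x \<partial>N)"
    proof -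
      have "space N - U (Suc k) \<in> sets (G k)"
        using sets.compl_sets[OF U_G[of k]] by (simp add: sp)
      from supermartingale_set_integral_le[OF fin sm this, of "Suc k"] show ?thesis by simp
    qed
    \<comment> \<open>The two integrands differ only at points crossing for the first time at index
      \<open>k\<close>, where \<open>c \<le> S k\<close>.\<close>
    also have "\<dots> \<le> c * measure N (U k) + (\<integral>x\<in>space N - U k. S k x \<partial>N)"
      unfolding val[symmetric]
    proof (intro integral_mono Bochner_Integration.integrable_add intU intB)
      fix x assume x: "x \<in> space N"
      show "c * indicator (U (Suc k)) x + indicator (space N - U (Suc k)) x * S k x
          \<le> c * indicator (U k) x + indicator (space N - U k) x * S k x"
        using nn[OF x, of k] x by (auto simp: U_def indicator_def less_Suc_eq)
    qed
    also have "\<dots> \<le> (\<integral>\<omega>. S 0 \<omega> \<partial>N)" by (rule Suc)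
    finally show ?case .
  qed
  have le: "c * measure N (U k) \<le> (\<integral>\<omega>. S 0 \<omega> \<partial>N)" for k
  proof -
    have "0 \<le> (\<integral>x\<in>space N - U k. S k x \<partial>N)"
      unfolding set_lebesgue_integral_def using nn by (intro Bochner_Integration.integral_nonneg) (auto simp: indicator_def)
    with main[of k] show ?thesis by simp
  qed
  have "(\<lambda>k. measure N (U k)) \<longlonglongrightarrow> measure N (\<Union>k. U k)"
  proof (rule finite_Lim_measure_incseq)
    show "incseq U" by (rule incseq_SucI) (auto simp: U_def less_Suc_eq)
  qed (use U_N in blast)
  then have "(\<lambda>k. c * measure N (U k)) \<longlonglongrightarrow> c * measure N (\<Union>k. U k)"
    by (intro tendsto_mult_left)
  then have "c * measure N (\<Union>k. U k) \<le> (\<integral>\<omega>. S 0 \<omega> \<partial>N)"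
    by (rule LIMSEQ_le_const2) (use le in auto)
  also have "(\<Union>k. U k) = {\<omega>\<in>space N. \<exists>k. c \<le> S k \<omega>}" by (auto simp: U_def)
  finally show ?thesis .
qed

lemma supermartingale_imp_testable:
  assumes \<P>: "\<P> \<subseteq> space (prob_algebra M)" "\<P> \<noteq> {}" and \<Q>: "\<Q> \<subseteq> space (prob_algebra M)"
    and S: "\<And>k. S k \<in> borel_measurable (nat_filtration M (enat (t k)))"
    and nn: "\<And>k \<omega>. \<omega> \<in> space (seq_measure M) \<Longrightarrow> 0 \<le> S k \<omega>"
    and S0: "\<And>\<omega>. \<omega> \<in> space (seq_measure M) \<Longrightarrow> S 0 \<omega> = 1"
    and sm: "\<And>P. P \<in> \<P> \<Longrightarrow> supermartingale (seq_measure P) (\<lambda>k. nat_filtration M (enat (t k))) S"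
    and lim: "\<And>Q. Q \<in> \<Q> \<Longrightarrow> AE \<omega> in seq_measure Q. filterlim (\<lambda>k. S k \<omega>) at_top sequentially"
    and \<alpha>: "0 < \<alpha>"
  shows "testable M \<P> \<Q> \<alpha>"
proof (rule testable_hitting_time)
  \<comment> \<open>\<open>A n\<close> gathers the crossings that are visible in the first
    \<open>n\<close> observations. Possibly infinitely many \<open>k\<close> satisfy
    \<open>t k \<le> n\<close>, so the union is treated as a countable one.\<close>
  define A where "A n = (\<Union>k\<in>{k. t k \<le> n}. {\<omega>\<in>space (nat_filtration M (enat (t k))). 1 / \<alpha> \<le> S k \<omega>})" for n
  show A: "A n \<in> sets (nat_filtration M (enat n))" for n
    unfolding A_def
  proof (rule sets.countable_UN')
    show "(\<lambda>k. {\<omega>\<in>space (nat_filtration M (enat (t k))). 1 / \<alpha> \<le> S k \<omega>}) ` {k. t k \<le> n}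
        \<subseteq> sets (nat_filtration M (enat n))"
    proof safe
      fix k assume "t k \<le> n"
      then show "{\<omega>\<in>space (nat_filtration M (enat (t k))). 1 / \<alpha> \<le> S k \<omega>} \<in> sets (nat_filtration M (enat n))"
        using borel_measurable_le[OF borel_measurable_const S[of k]]
          sets_nat_filtration_mono[of "enat (t k)" "enat n" M] by auto
    qed
  qed auto
  show "stop_prob P (hitting_time A) \<le> \<alpha>" if "P \<in> \<P>" for P
  proof -
    have P: "P \<in> space (prob_algebra M)" using \<P> that by blast
    interpret prob_space "seq_measure P" by (rule prob_space_iid[OF P])
    let ?V = "{\<omega>\<in>space (seq_measure P). \<exists>k. 1 / \<alpha> \<le> S k \<omega>}"
    have "1 / \<alpha> * measure (seq_measure P) ?V \<le> (\<integral>\<omega>. S 0 \<omega> \<partial>seq_measure P)"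
      using sm[OF that] nn \<alpha> by (intro Ville_inequality finite_measure_axioms) (auto simp: sets_iid[OF P])
    also have "(\<integral>\<omega>. S 0 \<omega> \<partial>seq_measure P) = (\<integral>\<omega>. 1 \<partial>seq_measure P)"
      by (intro Bochner_Integration.integral_cong refl S0) (simp only: sets_iid[OF P])
    finally have V: "measure (seq_measure P) ?V \<le> \<alpha>"
      using \<alpha> prob_space by (simp add: field_simps)
    have V_sets: "?V \<in> events"
    proof -
      have "{\<omega>\<in>space (seq_measure P). 1 / \<alpha> \<le> S k \<omega>} \<in> events" for k
        by (intro borel_measurable_le borel_measurable_const measurable_nat_filtration_iid[OF P S])
      then have "(\<Union>k. {\<omega>\<in>space (seq_measure P). 1 / \<alpha> \<le> S k \<omega>}) \<in> events" by blast
      also have "(\<Union>k. {\<omega>\<in>space (seq_measure P). 1 / \<alpha> \<le> S k \<omega>}) = ?V" by blast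
      finally show ?thesis .
    qed
    have "stop_prob P (hitting_time A) \<le> measure (seq_measure P) ?V"
      unfolding stop_prob_def hitting_time_finite_iff
      by (intro finite_measure_mono V_sets) (auto simp: A_def)
    with V show ?thesis by simp
  qed
  show "AE \<omega> in seq_measure Q. \<exists>n\<ge>1. \<omega> \<in> A n" if "Q \<in> \<Q>" for Q
    using lim[OF that]
  proof (rule AE_mp, intro AE_I2 impI)
    have Q: "Q \<in> space (prob_algebra M)" using \<Q> that by blast
    fix \<omega> assume \<omega>: "\<omega> \<in> space (seq_measure Q)" and l: "filterlim (\<lambda>k. S k \<omega>) at_top sequentially"
    have \<omega>': "\<omega> \<in> space (seq_measure M)" using \<omega> by (simp only: sets_iid[OF Q])
    obtain k where "1 / \<alpha> \<le> S k \<omega>"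
      using l unfolding filterlim_at_top eventually_sequentially by blast
    \<comment> \<open>The maximum with \<open>1\<close> covers a crossing at clock time
      \<open>t k = 0\<close>.\<close>
    then show "\<exists>n\<ge>1. \<omega> \<in> A n"
      using \<omega>' by (intro exI[of _ "max 1 (t k)"]) (auto simp: A_def intro!: exI[of _ k])
  qed
qed (use \<P> \<Q> in auto)

section \<open>Symmetrization\<close>

text \<open>Points of the finite product equal \<open>undefined\<close> outside
  \<open>{..<n}\<close>, and a permutation of \<open>{..<n}\<close> fixes those indices. So
  composition agrees with the restricted form, for which measurability and image laws are
  available.\<close>

lemma comp_permutes_space:
  assumes "\<pi> permutes {..<n}" "x \<in> space (pow_measure M n)"
  shows "x \<circ> \<pi> = (\<lambda>i\<in>{..<n}. x (\<pi> i))" "x \<circ> \<pi> \<in> space (pow_measure M n)"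
proof -
  have "x i = undefined" if "i \<notin> {..<n}" for i
    using assms(2) that by (auto simp: space_PiM PiE_iff extensional_def)
  then show *: "x \<circ> \<pi> = (\<lambda>i\<in>{..<n}. x (\<pi> i))"
    using permutes_not_in[OF assms(1)] by (auto simp: fun_eq_iff restrict_def)
  show "x \<circ> \<pi> \<in> space (pow_measure M n)"
    unfolding * using assms permutes_in_image[OF assms(1)] by (auto simp: space_PiM PiE_iff)
qed

lemma measurable_comp_permutes:
  assumes "\<pi> permutes {..<n}"
  shows "(\<lambda>x. \<lambda>i\<in>{..<n}. x (\<pi> i)) \<in> pow_measure M n \<rightarrow>\<^sub>M pow_measure M n"
  using permutes_in_image[OF assms] by (intro measurable_restrict measurable_component_singleton) auto

text \<open>An i.i.d. law is exchangeable: reindexing along an injection leaves it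
  unchanged.\<close>

lemma integral_comp_permutes:
  assumes R: "R \<in> space (prob_algebra M)" and \<pi>: "\<pi> permutes {..<n}"
    and h: "h \<in> borel_measurable (pow_measure M n)"
  shows "(\<integral>x. h (x \<circ> \<pi>) \<partial>pow_measure R n) = (\<integral>x. (h x :: real) \<partial>pow_measure R n)"
proof -
  let ?f = "\<lambda>x. \<lambda>i\<in>{..<n}. x (\<pi> i)"
  have distr: "distr (pow_measure R n) (pow_measure R n) ?f = pow_measure R n"
    using permutes_in_image[OF \<pi>] permutes_inj_on[OF \<pi>] prob_algebraD[OF R]
    by (intro distr_PiM_reindex) auto
  have "(\<integral>x. h (x \<circ> \<pi>) \<partial>pow_measure R n) = (\<integral>x. h (?f x) \<partial>pow_measure R n)"
    by (intro Bochner_Integration.integral_cong refl) (simp only: comp_permutes_space[OF \<pi>])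
  also have "\<dots> = (\<integral>x. h x \<partial>distr (pow_measure R n) (pow_measure R n) ?f)"
    using h measurable_iid[OF R] by (intro integral_distr[symmetric] measurable_comp_permutes[OF \<pi>]) blast
  finally show ?thesis unfolding distr .
qed

text \<open>Averaging \<open>h\<close> over the symmetric group yields a symmetric function, keeps
  the bound, and by exchangeability keeps the expectation under every i.i.d. law.\<close>

lemma bounded_estimable_integral:
  assumes h: "bounded_measurable (pow_measure M n) h"
  shows "bounded_estimable M n (\<lambda>R. \<integral>x. h x \<partial>pow_measure R n)"
proof -
  define G where "G = {\<pi>. \<pi> permutes {..<n}}"
  define g where "g x = (\<Sum>\<pi>\<in>G. h (x \<circ> \<pi>)) / real (card G)" for x
  have fin: "finite G" unfolding G_def by (intro finite_permutations) auto
  have "id \<in> G" by (auto simp: G_def permutes_id)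
  then have card: "0 < card G" using fin card_gt_0_iff by blast
  have hm: "h \<in> borel_measurable (pow_measure M n)" using h by (simp add: bounded_measurable_def)
  have comp: "(\<lambda>x. h (x \<circ> \<pi>)) \<in> borel_measurable (pow_measure M n)" if "\<pi> \<in> G" for \<pi>
  proof -
    have \<pi>: "\<pi> permutes {..<n}" using that by (simp add: G_def)
    have "(\<lambda>x. h (\<lambda>i\<in>{..<n}. x (\<pi> i))) \<in> borel_measurable (pow_measure M n)"
      by (rule measurable_compose[OF measurable_comp_permutes[OF \<pi>] hm])
    then show ?thesis by (subst measurable_cong) (simp_all only: comp_permutes_space[OF \<pi>])
  qed
  obtain c where c: "\<And>x. x \<in> space (pow_measure M n) \<Longrightarrow> norm (h x) \<le> c"
    using h unfolding bounded_measurable_def bounded_iff by blast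
  have bd: "bounded_measurable (pow_measure M n) (\<lambda>x. h (x \<circ> \<pi>))" if "\<pi> \<in> G" for \<pi>
    using comp[OF that] c comp_permutes_space(2)[of \<pi> n _ M] that
    by (auto simp: bounded_measurable_def bounded_iff G_def intro!: exI[of _ c])
  have "bounded_measurable (pow_measure M n) g"
    unfolding bounded_measurable_def
  proof
    show "g \<in> borel_measurable (pow_measure M n)"
      unfolding g_def using comp by (intro borel_measurable_divide borel_measurable_sum borel_measurable_const)
    have "norm (g x) \<le> c" if x: "x \<in> space (pow_measure M n)" for x
    proof -
      have "norm (\<Sum>\<pi>\<in>G. h (x \<circ> \<pi>)) \<le> (\<Sum>\<pi>\<in>G. c)"
        using c comp_permutes_space(2)[OF _ x] by (intro sum_norm_le) (auto simp: G_def)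
      then show ?thesis using card by (simp add: g_def field_simps)
    qed
    then show "bounded (g ` space (pow_measure M n))" unfolding bounded_iff by blast
  qed
  moreover have "symmetric_fun M n g"
    unfolding symmetric_fun_def
  proof (intro allI impI ballI)
    fix \<sigma> x assume "\<sigma> permutes {..<n}"
    \<comment> \<open>Composition with \<open>\<sigma>\<close> merely rearranges the summands, left
      multiplication being a bijection of the symmetric group.\<close>
    from setum_permutations_compose_left[OF this, of "\<lambda>\<pi>. h (x \<circ> \<pi>)"]
    show "g (x \<circ> \<sigma>) = g x" by (simp add: g_def G_def o_assoc)
  qed
  moreover have "(\<integral>x. h x \<partial>pow_measure R n) = (\<integral>x. g x \<partial>pow_measure R n)"
    if R: "R \<in> space (prob_algebra M)" for R
  proof -
    have "(\<integral>x. g x \<partial>pow_measure R n) = (\<Sum>\<pi>\<in>G. \<integral>x. h (x \<circ> \<pi>) \<partial>pow_measure R n) / real (card G)"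
      unfolding g_def using integrable_bounded_iid[OF R bd] by (simp add: Bochner_Integration.integral_sum)
    also have "\<dots> = (\<Sum>\<pi>\<in>G. \<integral>x. h x \<partial>pow_measure R n) / real (card G)"
      using integral_comp_permutes[OF R _ hm] by (simp add: G_def)
    also have "\<dots> = (\<integral>x. h x \<partial>pow_measure R n)" using card by simp
    finally show ?thesis by simp
  qed
  ultimately show ?thesis unfolding bounded_estimable_def by (intro exI[of _ g]) auto
qed

section \<open>Betting once per epoch\<close>

text \<open>Epoch \<open>j\<close> starts at coordinate \<open>j\<^sup>2\<close>; waiting until \<open>j \<ge> n\<close> ensures that the block fits into it.\<close>

definition wealth :: "nat \<Rightarrow> ((nat \<Rightarrow> 'a) \<Rightarrow> real) \<Rightarrow> nat \<Rightarrow> (nat \<Rightarrow> 'a) \<Rightarrow> real" where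
  "wealth n h r \<omega> = (\<Prod>j=n..<r. 1 + h (\<lambda>i\<in>{..<n}. \<omega> (j\<^sup>2 + i)))"

lemma wealth_Suc:
  "n \<le> r \<Longrightarrow> wealth n h (Suc r) \<omega> = wealth n h r \<omega> * (1 + h (\<lambda>i\<in>{..<n}. \<omega> (r\<^sup>2 + i)))"
  by (simp add: wealth_def)

lemma block_in_space:
  "\<omega> \<in> space (seq_measure M) \<Longrightarrow> (\<lambda>i\<in>{..<n}. \<omega> (T + i)) \<in> space (pow_measure M n)"
  by (auto simp: space_PiM PiE_iff)

text \<open>Consecutive squares differ by \<open>2 * j + 1\<close>, so a block of length
  \<open>n \<le> j\<close> begun at \<open>j\<^sup>2\<close> is fully observed by every later
  square.\<close>

lemma square_add_le: "n \<le> j \<Longrightarrow> j < r \<Longrightarrow> j\<^sup>2 + n \<le> (r::nat)\<^sup>2"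
proof -
  assume "n \<le> j" "j < r"
  then have "(Suc j)\<^sup>2 \<le> r\<^sup>2" by (intro power_mono) auto
  moreover have "j\<^sup>2 + n \<le> (Suc j)\<^sup>2" using \<open>n \<le> j\<close> by (simp add: power2_eq_square)
  ultimately show ?thesis by linarith
qed

section \<open>Wealth of a single gambler\<close>

context
  fixes M :: "'a measure" and n :: nat and h :: "(nat \<Rightarrow> 'a) \<Rightarrow> real"
  assumes h_meas: "h \<in> borel_measurable (pow_measure M n)"
    and h_bound: "\<forall>x\<in>space (pow_measure M n). \<bar>h x\<bar> \<le> 1 / 2"
begin

lemma wealth_measurable: "wealth n h r \<in> borel_measurable (nat_filtration M (enat (r\<^sup>2)))"
proof -
  have "(\<lambda>\<omega>. 1 + h (\<lambda>i\<in>{..<n}. \<omega> (j\<^sup>2 + i))) \<in> borel_measurable (nat_filtration M (enat (r\<^sup>2)))"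
    if "j \<in> {n..<r}" for j
  proof (rule borel_measurable_add[OF borel_measurable_const])
    show "(\<lambda>\<omega>. h (\<lambda>i\<in>{..<n}. \<omega> (j\<^sup>2 + i))) \<in> borel_measurable (nat_filtration M (enat (r\<^sup>2)))"
      using that by (intro measurable_compose[OF measurable_nat_filtration_block h_meas] square_add_le) auto
  qed
  then have "(\<lambda>\<omega>. \<Prod>j=n..<r. 1 + h (\<lambda>i\<in>{..<n}. \<omega> (j\<^sup>2 + i))) \<in> borel_measurable (nat_filtration M (enat (r\<^sup>2)))"
    by (rule borel_measurable_prod)
  then show ?thesis unfolding wealth_def[abs_def] .
qed

text \<open>The bound \<open>1 / 2\<close> on the bets excludes ruin and keeps reciprocals finite;
  the upper bound \<open>2\<close> is a convenient crude one.\<close>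

lemma wealth_factor:
  assumes "\<omega> \<in> space (seq_measure M)"
  shows "1 / 2 \<le> 1 + h (\<lambda>i\<in>{..<n}. \<omega> (T + i))" "1 + h (\<lambda>i\<in>{..<n}. \<omega> (T + i)) \<le> 2"
  using bspec[OF h_bound block_in_space[OF assms, of T]] by linarith+

lemma wealth_pos: "\<omega> \<in> space (seq_measure M) \<Longrightarrow> 0 < wealth n h r \<omega>"
  unfolding wealth_def using wealth_factor(1) by (intro prod_pos) (meson half_gt_zero less_le_trans zero_less_one)

text \<open>Uniform over all statistics, so that mixtures converge and are bounded, hence
  integrable, at each fixed epoch.\<close>

lemma wealth_le:
  assumes "\<omega> \<in> space (seq_measure M)"
  shows "wealth n h r \<omega> \<le> 2 ^ r"
proof -
  have "wealth n h r \<omega> \<le> (\<Prod>j=n..<r. 2)"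
    unfolding wealth_def
  proof (intro prod_mono conjI)
    fix j
    show "0 \<le> 1 + h (\<lambda>i\<in>{..<n}. \<omega> (j\<^sup>2 + i))" "1 + h (\<lambda>i\<in>{..<n}. \<omega> (j\<^sup>2 + i)) \<le> 2"
      using wealth_factor[OF assms, of "j\<^sup>2"] by linarith+
  qed
  also have "\<dots> \<le> 2 ^ r" by (simp add: power_increasing)
  finally show ?thesis .
qed

text \<open>The next factor is independent of \<open>A\<close> and of the current wealth and has
  null mean at most one. If \<open>r < n\<close>, betting has not begun and both wealths are empty
  products.\<close>

lemma wealth_step:
  assumes P: "P \<in> space (prob_algebra M)" and le0: "(\<integral>x. h x \<partial>pow_measure P n) \<le> 0"
    and A: "A \<in> sets (nat_filtration M (enat (r\<^sup>2)))"
  shows "(\<integral>\<^sup>+\<omega>. indicator A \<omega> * ennreal (wealth n h (Suc r) \<omega>) \<partial>seq_measure P)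
       \<le> (\<integral>\<^sup>+\<omega>. indicator A \<omega> * ennreal (wealth n h r \<omega>) \<partial>seq_measure P)"
proof (cases "n \<le> r")
  case True
  interpret Pn: prob_space "pow_measure P n" by (rule prob_space_iid[OF P])
  have bd: "bounded_measurable (pow_measure M n) h"
    using h_meas h_bound unfolding bounded_measurable_def bounded_iff by (auto intro!: exI[of _ "1/2"])
  have "(\<integral>\<^sup>+x. ennreal (1 + h x) \<partial>pow_measure P n) = ennreal (\<integral>x. 1 + h x \<partial>pow_measure P n)"
  proof (intro nn_integral_eq_integral AE_I2)
    fix x assume "x \<in> space (pow_measure P n)"
    then have "x \<in> space (pow_measure M n)" by (simp only: sets_iid[OF P])
    from bspec[OF h_bound this] show "0 \<le> 1 + h x" by linarith
  qed (use integrable_bounded_iid[OF P bd] in simp)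
  also have "\<dots> \<le> 1"
    using integrable_bounded_iid[OF P bd] le0 Pn.prob_space by (simp add: ennreal_le_1)
  finally have step: "(\<integral>\<^sup>+x. ennreal (1 + h x) \<partial>pow_measure P n) \<le> 1" .
  have f: "(\<lambda>\<omega>. indicator A \<omega> * ennreal (wealth n h r \<omega>)) \<in> borel_measurable (nat_filtration M (enat (r\<^sup>2)))"
    using A wealth_measurable by (intro borel_measurable_times_ennreal borel_measurable_indicator measurable_compose[OF _ measurable_ennreal])
  have g: "(\<lambda>x. ennreal (1 + h x)) \<in> borel_measurable (pow_measure M n)"
    using h_meas by (intro measurable_compose[OF _ measurable_ennreal] borel_measurable_add borel_measurable_const)
  have "(\<integral>\<^sup>+\<omega>. indicator A \<omega> * ennreal (wealth n h (Suc r) \<omega>) \<partial>seq_measure P)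
      = (\<integral>\<^sup>+\<omega>. (indicator A \<omega> * ennreal (wealth n h r \<omega>)) * ennreal (1 + h (\<lambda>i\<in>{..<n}. \<omega> (r\<^sup>2 + i))) \<partial>seq_measure P)"
  proof (rule nn_integral_cong)
    fix \<omega> assume "\<omega> \<in> space (seq_measure P)"
    then have "\<omega> \<in> space (seq_measure M)" by (simp only: sets_iid[OF P])
    then show "indicator A \<omega> * ennreal (wealth n h (Suc r) \<omega>)
        = (indicator A \<omega> * ennreal (wealth n h r \<omega>)) * ennreal (1 + h (\<lambda>i\<in>{..<n}. \<omega> (r\<^sup>2 + i)))"
      unfolding wealth_Suc[OF True] using less_imp_le[OF wealth_pos, of \<omega> r]
      by (simp add: ennreal_mult' mult.assoc)
  qed
  also have "\<dots> = (\<integral>\<^sup>+\<omega>. indicator A \<omega> * ennreal (wealth n h r \<omega>) \<partial>seq_measure P)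
      * (\<integral>\<^sup>+x. ennreal (1 + h x) \<partial>pow_measure P n)"
    by (rule nn_integral_past_times_block[OF P f g])
  also have "\<dots> \<le> (\<integral>\<^sup>+\<omega>. indicator A \<omega> * ennreal (wealth n h r \<omega>) \<partial>seq_measure P) * 1"
    by (intro mult_left_mono step) simp
  finally show ?thesis by simp
qed (simp add: wealth_def)

text \<open>The factors of different epochs are independent with the same law. The index
  \<open>r + n\<close> skips the idle epochs before \<open>n\<close>, so exactly \<open>r\<close>
  bets have been settled.\<close>

lemma nn_integral_inverse_wealth:
  assumes Q: "Q \<in> space (prob_algebra M)"
  shows "(\<integral>\<^sup>+\<omega>. ennreal (inverse (wealth n h (r + n) \<omega>)) \<partial>seq_measure Q)
       = (\<integral>\<^sup>+x. ennreal (inverse (1 + h x)) \<partial>pow_measure Q n) ^ r"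
proof (induction r)
  case 0
  interpret prob_space "seq_measure Q" by (rule prob_space_iid[OF Q])
  show ?case using emeasure_space_1 by (simp add: wealth_def)
next
  case (Suc r)
  let ?I = "\<integral>\<^sup>+x. ennreal (inverse (1 + h x)) \<partial>pow_measure Q n"
  have f: "(\<lambda>\<omega>. ennreal (inverse (wealth n h (r + n) \<omega>))) \<in> borel_measurable (nat_filtration M (enat ((r + n)\<^sup>2)))"
    using wealth_measurable by (intro measurable_compose[OF _ measurable_ennreal] borel_measurable_inverse)
  have g: "(\<lambda>x. ennreal (inverse (1 + h x))) \<in> borel_measurable (pow_measure M n)"
    using h_meas by (intro measurable_compose[OF _ measurable_ennreal] borel_measurable_inverse borel_measurable_add borel_measurable_const)
  have "(\<integral>\<^sup>+\<omega>. ennreal (inverse (wealth n h (Suc r + n) \<omega>)) \<partial>seq_measure Q)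
      = (\<integral>\<^sup>+\<omega>. ennreal (inverse (wealth n h (r + n) \<omega>)) * ennreal (inverse (1 + h (\<lambda>i\<in>{..<n}. \<omega> ((r + n)\<^sup>2 + i)))) \<partial>seq_measure Q)"
  proof (rule nn_integral_cong)
    fix \<omega> assume "\<omega> \<in> space (seq_measure Q)"
    then have "\<omega> \<in> space (seq_measure M)" by (simp only: sets_iid[OF Q])
    then have "0 \<le> inverse (wealth n h (r + n) \<omega>)" using wealth_pos[of \<omega> "r + n"] by simp
    moreover have "inverse (wealth n h (Suc r + n) \<omega>)
        = inverse (wealth n h (r + n) \<omega>) * inverse (1 + h (\<lambda>i\<in>{..<n}. \<omega> ((r + n)\<^sup>2 + i)))"
      using wealth_Suc[of n "r + n" h \<omega>] by (simp add: inverse_mult_distrib)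
    ultimately show "ennreal (inverse (wealth n h (Suc r + n) \<omega>))
        = ennreal (inverse (wealth n h (r + n) \<omega>)) * ennreal (inverse (1 + h (\<lambda>i\<in>{..<n}. \<omega> ((r + n)\<^sup>2 + i))))"
      by (simp only: ennreal_mult')
  qed
  also have "\<dots> = (\<integral>\<^sup>+\<omega>. ennreal (inverse (wealth n h (r + n) \<omega>)) \<partial>seq_measure Q) * ?I"
    by (rule nn_integral_past_times_block[OF Q f g])
  finally show ?case by (simp add: Suc mult.commute)
qed

text \<open>The expected reciprocals form a convergent geometric series, so their random sum is
  finite almost surely. Its terms then vanish and, being positive, have inverses diverging to plus
  infinity.\<close>

lemma wealth_tendsto:
  assumes Q: "Q \<in> space (prob_algebra M)"
    and lt: "(\<integral>\<^sup>+x. ennreal (inverse (1 + h x)) \<partial>pow_measure Q n) < 1"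
  shows "AE \<omega> in seq_measure Q. filterlim (\<lambda>r. wealth n h r \<omega>) at_top sequentially"
proof -
  obtain \<rho> where \<rho>: "0 \<le> \<rho>" "(\<integral>\<^sup>+x. ennreal (inverse (1 + h x)) \<partial>pow_measure Q n) = ennreal \<rho>"
    using lt by (cases "\<integral>\<^sup>+x. ennreal (inverse (1 + h x)) \<partial>pow_measure Q n") auto
  with lt have "\<rho> < 1" by (simp add: ennreal_less_one_iff)
  have m: "(\<lambda>\<omega>. ennreal (inverse (wealth n h (r + n) \<omega>))) \<in> borel_measurable (seq_measure Q)" for r
    by (intro measurable_compose[OF _ measurable_ennreal] borel_measurable_inverse
        measurable_nat_filtration_iid[OF Q wealth_measurable])
  have "(\<integral>\<^sup>+\<omega>. (\<Sum>r. ennreal (inverse (wealth n h (r + n) \<omega>))) \<partial>seq_measure Q)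
      = (\<Sum>r. ennreal (\<rho> ^ r))"
    using m \<rho> by (subst nn_integral_suminf) (simp_all add: nn_integral_inverse_wealth[OF Q] ennreal_power)
  also have "\<dots> = ennreal (\<Sum>r. \<rho> ^ r)"
    using \<rho> \<open>\<rho> < 1\<close> by (intro suminf_ennreal2 summable_geometric) auto
  finally have "(\<integral>\<^sup>+\<omega>. (\<Sum>r. ennreal (inverse (wealth n h (r + n) \<omega>))) \<partial>seq_measure Q) \<noteq> \<infinity>" by simp
  then have "AE \<omega> in seq_measure Q. (\<Sum>r. ennreal (inverse (wealth n h (r + n) \<omega>))) \<noteq> \<infinity>"
    by (intro nn_integral_PInf_AE borel_measurable_suminf_order m)
  then show ?thesis
  proof (rule AE_mp, intro AE_I2 impI)
    fix \<omega> assume "\<omega> \<in> space (seq_measure Q)" and fin: "(\<Sum>r. ennreal (inverse (wealth n h (r + n) \<omega>))) \<noteq> \<infinity>"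
    then have \<omega>: "\<omega> \<in> space (seq_measure M)" by (simp only: sets_iid[OF Q])
    have pos: "0 < inverse (wealth n h r \<omega>)" for r using wealth_pos[OF \<omega>, of r] by simp
    have "summable (\<lambda>r. inverse (wealth n h (r + n) \<omega>))"
      using fin less_imp_le[OF pos] by (intro summable_suminf_not_top) auto
    then have "(\<lambda>r. inverse (wealth n h (r + n) \<omega>)) \<longlonglongrightarrow> 0" by (rule summable_LIMSEQ_zero)
    then have "filterlim (\<lambda>r. inverse (inverse (wealth n h (r + n) \<omega>))) at_top sequentially"
      by (rule filterlim_inverse_at_top) (intro always_eventually allI pos)
    then have "filterlim (\<lambda>r. wealth n h (r + n) \<omega>) at_top sequentially" by simp
    then show "filterlim (\<lambda>r. wealth n h r \<omega>) at_top sequentially"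
      using eventually_sequentially_seg[of "\<lambda>r. Z \<le> wealth n h r \<omega>" n for Z] by (simp add: filterlim_at_top)
  qed
qed

end

text \<open>With \<open>\<mu>\<close> the mean of \<open>h\<close>, a second-order bound on the
  reciprocal gives the mean at most \<open>1 - b * \<mu> + 2 * b\<^sup>2\<close>, which is below one
  precisely when \<open>2 * b < \<mu>\<close>.\<close>

lemma integral_inverse_less_one:
  assumes Q: "prob_space N" and h: "h \<in> borel_measurable N"
    and hb: "\<And>x. x \<in> space N \<Longrightarrow> \<bar>h x\<bar> \<le> (1::real)"
    and b: "0 < b" "b \<le> 1 / 2" "2 * b < (\<integral>x. h x \<partial>N)"
  shows "(\<integral>\<^sup>+x. ennreal (inverse (1 + b * h x)) \<partial>N) < 1"
proof -
  interpret prob_space N by fact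
  have int: "integrable N h" using h hb by (intro integrable_const_bound[where B=1]) (auto intro!: AE_I2)
  have *: "0 \<le> 1 - b * h x + 2 * b\<^sup>2 \<and> inverse (1 + b * h x) \<le> 1 - b * h x + 2 * b\<^sup>2" if x: "x \<in> space N" for x
  proof -
    define y where "y = b * h x"
    have "\<bar>y\<bar> = b * \<bar>h x\<bar>" using b by (simp add: y_def abs_mult)
    also have "\<dots> \<le> b * 1" using hb[OF x] b by (intro mult_left_mono) auto
    finally have yb: "\<bar>y\<bar> \<le> b" by simp
    then have y2: "y\<^sup>2 \<le> b\<^sup>2" by (metis abs_le_square_iff abs_of_pos b(1))
    have y: "- (1/2) \<le> y" "y \<le> 1/2" using yb b by linarith+
    \<comment> \<open>The coefficient \<open>2\<close> leaves the remainder
      \<open>y\<^sup>2 * (1 + 2 * y)\<close>, which is nonnegative because \<open>y\<close> is at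
      least \<open>- (1/2)\<close>.\<close>
    have "1 \<le> (1 + y) * (1 - y + 2 * y\<^sup>2)"
    proof -
      have "(1 + y) * (1 - y + 2 * y\<^sup>2) = 1 + y\<^sup>2 * (1 + 2 * y)" by (simp add: algebra_simps power2_eq_square)
      moreover have "0 \<le> y\<^sup>2 * (1 + 2 * y)" using y by simp
      ultimately show ?thesis by simp
    qed
    also have "\<dots> \<le> (1 + y) * (1 - y + 2 * b\<^sup>2)" using y y2 by (intro mult_left_mono) auto
    finally have "inverse (1 + y) \<le> 1 - y + 2 * b\<^sup>2" using y by (simp add: field_simps)
    moreover have "0 \<le> 1 - y + 2 * b\<^sup>2" using y by simp
    ultimately show ?thesis unfolding y_def by simp
  qed
  have "(\<integral>\<^sup>+x. ennreal (inverse (1 + b * h x)) \<partial>N) \<le> (\<integral>\<^sup>+x. ennreal (1 - b * h x + 2 * b\<^sup>2) \<partial>N)"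
    using * by (intro nn_integral_mono ennreal_leI) blast
  also have "\<dots> = ennreal (\<integral>x. 1 - b * h x + 2 * b\<^sup>2 \<partial>N)"
    using * int by (intro nn_integral_eq_integral AE_I2) auto
  also have "(\<integral>x. 1 - b * h x + 2 * b\<^sup>2 \<partial>N) = 1 - b * (\<integral>x. h x \<partial>N) + 2 * b\<^sup>2"
    using int prob_space by simp
  also have "ennreal \<dots> < 1"
  proof -
    have "b * (2 * b) < b * (\<integral>x. h x \<partial>N)" using b by (intro mult_strict_left_mono)
    then have "1 - b * (\<integral>x. h x \<partial>N) + 2 * b\<^sup>2 < 1" by (simp add: power2_eq_square)
    then show ?thesis by (simp add: ennreal_less_one_iff)
  qed
  finally show ?thesis .
qed

section \<open>Mixtures of countably many gamblers\<close>

definition mixture :: "(nat \<Rightarrow> nat) \<Rightarrow> (nat \<Rightarrow> (nat \<Rightarrow> 'a) \<Rightarrow> real) \<Rightarrow> nat \<Rightarrow> (nat \<Rightarrow> 'a) \<Rightarrow> real" where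
  "mixture n h r \<omega> = (\<Sum>i. (1 / 2) ^ Suc i * wealth (n i) (h i) r \<omega>)"

text \<open>The weights sum to one and every gambler starts with an empty product.\<close>

lemma mixture_0: "mixture n h 0 \<omega> = 1"
  unfolding mixture_def using sums_unique[OF power_half_series] by (simp add: wealth_def)

context
  fixes M :: "'a measure" and n :: "nat \<Rightarrow> nat" and h :: "nat \<Rightarrow> (nat \<Rightarrow> 'a) \<Rightarrow> real"
  assumes h_meas: "\<And>i. h i \<in> borel_measurable (pow_measure M (n i))"
    and h_bound: "\<And>i. \<forall>x\<in>space (pow_measure M (n i)). \<bar>h i x\<bar> \<le> 1 / 2"
begin

lemma wealth_component_pos: "\<omega> \<in> space (seq_measure M) \<Longrightarrow> 0 < wealth (n i) (h i) r \<omega>"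
  using wealth_pos[where M=M and n="n i" and h="h i", OF h_meas h_bound] by blast

lemma wealth_component_le: "\<omega> \<in> space (seq_measure M) \<Longrightarrow> wealth (n i) (h i) r \<omega> \<le> 2 ^ r"
  using wealth_le[where M=M and n="n i" and h="h i", OF h_meas h_bound] by blast

lemma mixture_summable:
  assumes "\<omega> \<in> space (seq_measure M)"
  shows "summable (\<lambda>i. (1 / 2) ^ Suc i * wealth (n i) (h i) r \<omega>)"
proof (rule summable_comparison_test')
  show "summable (\<lambda>i. (1 / 2) ^ Suc i * (2 ^ r :: real))"
    by (intro summable_mult2 sums_summable[OF power_half_series])
  show "norm ((1 / 2) ^ Suc i * wealth (n i) (h i) r \<omega>) \<le> (1 / 2) ^ Suc i * 2 ^ r" if "0 \<le> i" for i
    using wealth_component_pos[OF assms, of i r] wealth_component_le[OF assms, of i r]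
    by (simp add: abs_mult)
qed

text \<open>The other terms are nonnegative. Thus a single gambler whose wealth diverges carries the
  whole mixture to infinity.\<close>

lemma mixture_ge:
  assumes "\<omega> \<in> space (seq_measure M)"
  shows "(1 / 2) ^ Suc i * wealth (n i) (h i) r \<omega> \<le> mixture n h r \<omega>"
proof -
  have "(\<Sum>i\<in>{i}. (1 / 2) ^ Suc i * wealth (n i) (h i) r \<omega>) \<le> mixture n h r \<omega>"
    unfolding mixture_def
  proof (intro sum_le_suminf mixture_summable[OF assms])
    show "0 \<le> (1 / 2) ^ Suc i * wealth (n i) (h i) r \<omega>" for i
      using less_imp_le[OF wealth_component_pos[OF assms]] by (intro mult_nonneg_nonneg) simp_all
  qed simp
  then show ?thesis by simp
qed

lemma mixture_nonneg: "\<omega> \<in> space (seq_measure M) \<Longrightarrow> 0 \<le> mixture n h r \<omega>"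
  using mixture_ge[of \<omega> 0 r] wealth_component_pos[of \<omega> 0 r] by simp

lemma mixture_le:
  assumes "\<omega> \<in> space (seq_measure M)"
  shows "mixture n h r \<omega> \<le> 2 ^ r"
proof -
  have "mixture n h r \<omega> \<le> (\<Sum>i. (1 / 2) ^ Suc i * 2 ^ r)"
    unfolding mixture_def
  proof (intro suminf_le mixture_summable[OF assms])
    show "(1 / 2) ^ Suc i * wealth (n i) (h i) r \<omega> \<le> (1 / 2) ^ Suc i * 2 ^ r" for i
      using wealth_component_le[OF assms] by (intro mult_left_mono) auto
    show "summable (\<lambda>i. (1 / 2) ^ Suc i * (2 ^ r :: real))"
      by (intro summable_mult2 sums_summable[OF power_half_series])
  qed
  also have "(\<Sum>i. (1 / 2) ^ Suc i * (2 ^ r :: real)) = 1 * 2 ^ r"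
    by (intro sums_unique[symmetric] sums_mult2 power_half_series)
  finally show ?thesis by simp
qed

lemma mixture_measurable: "mixture n h r \<in> borel_measurable (nat_filtration M (enat (r\<^sup>2)))"
proof -
  have "wealth (n i) (h i) r \<in> borel_measurable (nat_filtration M (enat (r\<^sup>2)))" for i
    by (rule wealth_measurable[OF h_meas h_bound])
  then show ?thesis
    unfolding mixture_def[abs_def] by (intro borel_measurable_suminf borel_measurable_times borel_measurable_const)
qed

lemma ennreal_mixture:
  assumes "\<omega> \<in> space (seq_measure M)"
  shows "ennreal (mixture n h r \<omega>) = (\<Sum>i. ennreal ((1 / 2) ^ Suc i) * ennreal (wealth (n i) (h i) r \<omega>))"
proof -
  have "ennreal (mixture n h r \<omega>) = (\<Sum>i. ennreal ((1 / 2) ^ Suc i * wealth (n i) (h i) r \<omega>))"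
    unfolding mixture_def using less_imp_le[OF wealth_component_pos[OF assms]]
    by (intro suminf_ennreal2[symmetric] mixture_summable[OF assms] mult_nonneg_nonneg) simp_all
  then show ?thesis by (simp only: ennreal_mult' zero_le_power zero_le_divide_1_iff zero_le_numeral)
qed

text \<open>In \<open>ennreal\<close> sum and integral may always be exchanged, so the null
  inequality can be checked for each gambler separately.\<close>

lemma nn_integral_mixture:
  assumes P: "P \<in> space (prob_algebra M)" and A: "A \<in> sets (seq_measure P)"
  shows "(\<integral>\<^sup>+\<omega>. indicator A \<omega> * ennreal (mixture n h r \<omega>) \<partial>seq_measure P)
    = (\<Sum>i. ennreal ((1 / 2) ^ Suc i) * (\<integral>\<^sup>+\<omega>. indicator A \<omega> * ennreal (wealth (n i) (h i) r \<omega>) \<partial>seq_measure P))"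
proof -
  have m: "(\<lambda>\<omega>. indicator A \<omega> * ennreal (wealth (n i) (h i) r \<omega>)) \<in> borel_measurable (seq_measure P)" for i
    using A by (intro borel_measurable_times_ennreal borel_measurable_indicator measurable_compose[OF _ measurable_ennreal]
        measurable_nat_filtration_iid[OF P wealth_measurable[OF h_meas h_bound]])
  have "(\<integral>\<^sup>+\<omega>. indicator A \<omega> * ennreal (mixture n h r \<omega>) \<partial>seq_measure P)
    = (\<integral>\<^sup>+\<omega>. (\<Sum>i. ennreal ((1 / 2) ^ Suc i) * (indicator A \<omega> * ennreal (wealth (n i) (h i) r \<omega>))) \<partial>seq_measure P)"
  proof (rule nn_integral_cong)
    fix \<omega> assume "\<omega> \<in> space (seq_measure P)"
    then have "\<omega> \<in> space (seq_measure M)" by (simp only: sets_iid[OF P])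
    then show "indicator A \<omega> * ennreal (mixture n h r \<omega>)
      = (\<Sum>i. ennreal ((1 / 2) ^ Suc i) * (indicator A \<omega> * ennreal (wealth (n i) (h i) r \<omega>)))"
      by (simp add: ennreal_mixture indicator_def del: power_Suc)
  qed
  also have "\<dots> = (\<Sum>i. \<integral>\<^sup>+\<omega>. ennreal ((1 / 2) ^ Suc i) * (indicator A \<omega> * ennreal (wealth (n i) (h i) r \<omega>)) \<partial>seq_measure P)"
    by (intro nn_integral_suminf borel_measurable_times_ennreal m borel_measurable_const)
  finally show ?thesis by (simp only: nn_integral_cmult[OF m])
qed

lemma mixture_integrable:
  assumes P: "P \<in> space (prob_algebra M)"
  shows "integrable (seq_measure P) (mixture n h r)"
proof -
  interpret prob_space "seq_measure P" by (rule prob_space_iid[OF P])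
  show ?thesis
  proof (rule integrable_const_bound[where B="2 ^ r"])
    show "AE \<omega> in seq_measure P. norm (mixture n h r \<omega>) \<le> 2 ^ r"
    proof (rule AE_I2)
      fix \<omega> assume "\<omega> \<in> space (seq_measure P)"
      then have "\<omega> \<in> space (seq_measure M)" by (simp only: sets_iid[OF P])
      then show "norm (mixture n h r \<omega>) \<le> 2 ^ r"
        using mixture_le[of \<omega> r] mixture_nonneg[of \<omega> r] by simp
    qed
  qed (rule measurable_nat_filtration_iid[OF P mixture_measurable])
qed

text \<open>\<open>wealth_step\<close> bounds each gambler over one epoch; weighted summation passes
  this to the mixture, and induction runs from \<open>r\<close> to \<open>s\<close>. The event
  \<open>A\<close> stays fixed, since it belongs to all later sigma-algebras.\<close>

lemma mixture_set_integral_antimono: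
  assumes P: "P \<in> space (prob_algebra M)" and le0: "\<And>i. (\<integral>x. h i x \<partial>pow_measure P (n i)) \<le> 0"
    and A: "A \<in> sets (nat_filtration M (enat (r\<^sup>2)))" and "r \<le> s"
  shows "(\<integral>\<omega>\<in>A. mixture n h s \<omega> \<partial>seq_measure P) \<le> (\<integral>\<omega>\<in>A. mixture n h r \<omega> \<partial>seq_measure P)"
proof -
  have AP: "A \<in> sets (seq_measure P)" using A sets_nat_filtration_iid[OF P] by blast
  have "(\<integral>\<^sup>+\<omega>. indicator A \<omega> * ennreal (mixture n h s \<omega>) \<partial>seq_measure P)
      \<le> (\<integral>\<^sup>+\<omega>. indicator A \<omega> * ennreal (mixture n h r \<omega>) \<partial>seq_measure P)"
    using \<open>r \<le> s\<close>
  proof (induction s rule: dec_induct)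
    case (step k)
    have "r\<^sup>2 \<le> k\<^sup>2" using step.hyps by (intro power_mono) auto
    then have Ak: "A \<in> sets (nat_filtration M (enat (k\<^sup>2)))"
      using A sets_nat_filtration_mono[of "enat (r\<^sup>2)" "enat (k\<^sup>2)" M] by auto
    have "(\<integral>\<^sup>+\<omega>. indicator A \<omega> * ennreal (mixture n h (Suc k) \<omega>) \<partial>seq_measure P)
        \<le> (\<integral>\<^sup>+\<omega>. indicator A \<omega> * ennreal (mixture n h k \<omega>) \<partial>seq_measure P)"
      unfolding nn_integral_mixture[OF P AP]
    proof (intro suminf_le summableI mult_left_mono)
      show "(\<integral>\<^sup>+\<omega>. indicator A \<omega> * ennreal (wealth (n i) (h i) (Suc k) \<omega>) \<partial>seq_measure P)
         \<le> (\<integral>\<^sup>+\<omega>. indicator A \<omega> * ennreal (wealth (n i) (h i) k \<omega>) \<partial>seq_measure P)" for i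
        by (rule wealth_step[OF h_meas h_bound P le0 Ak])
    qed simp
    with step.IH show ?case by (rule order_trans[rotated])
  qed simp
  \<comment> \<open>Integrability and nonnegativity of the mixture carry the inequality back from
    nonnegative to real integrals.\<close>
  moreover have "(\<integral>\<^sup>+\<omega>. indicator A \<omega> * ennreal (mixture n h k \<omega>) \<partial>seq_measure P)
      = ennreal (\<integral>\<omega>\<in>A. mixture n h k \<omega> \<partial>seq_measure P)" (is "_ = ennreal ?r")
    and "0 \<le> (\<integral>\<omega>\<in>A. mixture n h k \<omega> \<partial>seq_measure P)" for k
  proof -
    have nn: "0 \<le> indicator A \<omega> * mixture n h k \<omega>" if "\<omega> \<in> space (seq_measure P)" for \<omega>
    proof -
      have "\<omega> \<in> space (seq_measure M)" using that by (simp only: sets_iid[OF P])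
      then show ?thesis using mixture_nonneg[of \<omega> k] by simp
    qed
    have "(\<integral>\<^sup>+\<omega>. indicator A \<omega> * ennreal (mixture n h k \<omega>) \<partial>seq_measure P)
        = (\<integral>\<^sup>+\<omega>. ennreal (indicator A \<omega> * mixture n h k \<omega>) \<partial>seq_measure P)"
      by (intro nn_integral_cong) (simp add: indicator_def)
    also have "\<dots> = ennreal (\<integral>\<omega>. indicator A \<omega> * mixture n h k \<omega> \<partial>seq_measure P)"
      using integrable_mult_indicator[OF AP mixture_integrable[OF P, of k]] nn
      by (intro nn_integral_eq_integral AE_I2) simp_all
    finally show "(\<integral>\<^sup>+\<omega>. indicator A \<omega> * ennreal (mixture n h k \<omega>) \<partial>seq_measure P) = ennreal (\<integral>\<omega>\<in>A. mixture n h k \<omega> \<partial>seq_measure P)"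
      by (simp add: set_lebesgue_integral_def)
    show "0 \<le> (\<integral>\<omega>\<in>A. mixture n h k \<omega> \<partial>seq_measure P)"
      unfolding set_lebesgue_integral_def using nn by (intro Bochner_Integration.integral_nonneg) simp
  qed
  ultimately show ?thesis by (simp add: ennreal_le_iff)
qed

end

section \<open>The clock of squares and the final process\<close>

lemma floor_sqrt_power2_asymp: "(\<lambda>k. real ((floor_sqrt k)\<^sup>2) / real k) \<longlonglongrightarrow> 1"
proof (rule tendsto_sandwich)
  show "(\<lambda>k. 1 - 2 * inverse (sqrt (real k))) \<longlonglongrightarrow> 1"
  proof -
    have "(\<lambda>k. inverse (sqrt (real k))) \<longlonglongrightarrow> 0"
      by (intro tendsto_inverse_0_at_top filterlim_compose[OF sqrt_at_top filterlim_real_sequentially])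
    then have "(\<lambda>k. 1 - 2 * inverse (sqrt (real k))) \<longlonglongrightarrow> 1 - 2 * 0" by (intro tendsto_intros)
    then show ?thesis by simp
  qed
  show "\<forall>\<^sub>F k in sequentially. 1 - 2 * inverse (sqrt (real k)) \<le> real ((floor_sqrt k)\<^sup>2) / real k"
  proof (rule eventually_sequentiallyI[of 1])
    fix k :: nat assume k: "1 \<le> k"
    let ?s = "floor_sqrt k"
    \<comment> \<open>Since \<open>k\<close> lies below the next square, the clock lags by at most
      \<open>2 * ?s\<close>, which is of order \<open>sqrt k\<close> and negligible against
      \<open>k\<close>.\<close>
    have "k \<le> ?s\<^sup>2 + 2 * ?s" using Suc_floor_sqrt_power2_gt[of k] by (simp add: power2_eq_square)
    then have "real k \<le> real (?s\<^sup>2 + 2 * ?s)" by (rule of_nat_mono)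
    then have 1: "real k \<le> real (?s\<^sup>2) + 2 * real ?s" by simp
    have "real (?s\<^sup>2) \<le> real k" by (intro of_nat_mono floor_sqrt_power2_le)
    then have 2: "real ?s \<le> sqrt (real k)" by (intro real_le_rsqrt) simp
    have "real k - 2 * sqrt (real k) \<le> real (?s\<^sup>2)" using 1 2 by linarith
    then have "(real k - 2 * sqrt (real k)) / real k \<le> real (?s\<^sup>2) / real k" by (intro divide_right_mono) auto
    also have "(real k - 2 * sqrt (real k)) / real k = 1 - 2 * inverse (sqrt (real k))"
    proof -
      have "sqrt (real k) / real k = inverse (sqrt (real k))"
        using k real_sqrt_mult_self[of "real k"] by (simp add: field_simps)
      then show ?thesis using k by (simp add: diff_divide_distrib)
    qed
    finally show "1 - 2 * inverse (sqrt (real k)) \<le> real (?s\<^sup>2) / real k" .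
  qed
  show "\<forall>\<^sub>F k in sequentially. real ((floor_sqrt k)\<^sup>2) / real k \<le> 1"
  proof (rule eventually_sequentiallyI[of 1])
    fix k :: nat assume "1 \<le> k"
    have "real ((floor_sqrt k)\<^sup>2) \<le> real k" by (intro of_nat_mono floor_sqrt_power2_le)
    then show "real ((floor_sqrt k)\<^sup>2) / real k \<le> 1" using \<open>1 \<le> k\<close> by simp
  qed
qed simp

lemma separation_imp_supermartingale:
  fixes M :: "'a measure" and n :: "nat \<Rightarrow> nat" and h :: "nat \<Rightarrow> (nat \<Rightarrow> 'a) \<Rightarrow> real"
  assumes \<P>: "\<P> \<subseteq> space (prob_algebra M)" and \<Q>: "\<Q> \<subseteq> space (prob_algebra M)"
    and h: "\<And>m. bounded_measurable (pow_measure M (n m)) (h m)"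
    and hP: "\<And>m P. P \<in> \<P> \<Longrightarrow> (\<integral>x. h m x \<partial>pow_measure P (n m)) \<le> 0"
    and hQ: "\<And>Q. Q \<in> \<Q> \<Longrightarrow> \<exists>m. (\<integral>x. h m x \<partial>pow_measure Q (n m)) > 0"
  shows "\<exists>(t :: nat \<Rightarrow> nat) (S :: nat \<Rightarrow> (nat \<Rightarrow> 'a) \<Rightarrow> real).
         t 0 = 0 \<and> mono t \<and> (\<forall>k. t k \<le> k) \<and> (\<lambda>k. real (t k) / real k) \<longlonglongrightarrow> 1 \<and>
         (\<forall>k. \<forall>\<omega>\<in>space (seq_measure M). 0 \<le> S k \<omega>) \<and>
         (\<forall>k. S k \<in> borel_measurable (nat_filtration M (enat (t k)))) \<and>
         (\<forall>\<omega>\<in>space (seq_measure M). S 0 \<omega> = 1) \<and>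
         (\<forall>P\<in>\<P>. supermartingale (seq_measure P) (\<lambda>k. nat_filtration M (enat (t k))) S) \<and>
         (\<forall>Q\<in>\<Q>. AE \<omega> in seq_measure Q. filterlim (\<lambda>k. S k \<omega>) at_top sequentially)"
proof -
  have "\<exists>c>0. \<forall>x\<in>space (pow_measure M (n m)). \<bar>h m x\<bar> \<le> c" for m
    using h[of m] unfolding bounded_measurable_def bounded_pos by auto
  then obtain c where c: "\<And>m. 0 < c m" "\<And>m x. x \<in> space (pow_measure M (n m)) \<Longrightarrow> \<bar>h m x\<bar> \<le> c m"
    by metis
  \<comment> \<open>These stakes are at most \<open>1 / 2\<close>, as bets require, and tend to
    zero, so one of them lies below half of any given positive mean.\<close>
  define b where "b j = 1 / (real j + 2)" for j
  have b: "0 < b j" "b j \<le> 1 / 2" for j by (auto simp: b_def field_simps)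
  \<comment> \<open>Normalization to absolute value at most one; dividing by the positive
    \<open>c m\<close> preserves the signs of all means.\<close>
  define u where "u m x = h m x / c m" for m x
  \<comment> \<open>\<open>prod_decode\<close> arranges all pairs of a statistic and a stake in one
    sequence of gamblers.\<close>
  define N where "N i = n (fst (prod_decode i))" for i
  define g where "g i x = b (snd (prod_decode i)) * u (fst (prod_decode i)) x" for i x
  have u_bound: "\<bar>u m x\<bar> \<le> 1" if "x \<in> space (pow_measure M (n m))" for m x
    using c(1)[of m] c(2)[OF that] by (simp add: u_def abs_divide)
  have u_meas: "u m \<in> borel_measurable (pow_measure M (n m))" for m
    unfolding u_def[abs_def] using h[of m]
    by (intro borel_measurable_divide borel_measurable_const) (simp add: bounded_measurable_def)
  have g_meas: "g i \<in> borel_measurable (pow_measure M (N i))" for i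
    unfolding g_def[abs_def] N_def by (intro borel_measurable_times borel_measurable_const u_meas)
  have g_bound: "\<forall>x\<in>space (pow_measure M (N i)). \<bar>g i x\<bar> \<le> 1 / 2" for i
  proof
    fix x assume x: "x \<in> space (pow_measure M (N i))"
    have "\<bar>g i x\<bar> = b (snd (prod_decode i)) * \<bar>u (fst (prod_decode i)) x\<bar>"
      using b(1)[of "snd (prod_decode i)"] by (simp add: g_def abs_mult)
    also have "\<dots> \<le> 1 / 2 * 1"
      using x b u_bound by (intro mult_mono) (auto simp: N_def)
    finally show "\<bar>g i x\<bar> \<le> 1 / 2" by simp
  qed
  have g_P: "(\<integral>x. g i x \<partial>pow_measure P (N i)) \<le> 0" if "P \<in> \<P>" for P i
    using hP[OF that, of "fst (prod_decode i)"] b(1)[of "snd (prod_decode i)"] c(1)[of "fst (prod_decode i)"]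
    by (simp add: g_def u_def N_def mult_nonneg_nonpos divide_nonpos_pos)
  let ?t = "\<lambda>k. (floor_sqrt k)\<^sup>2"
  \<comment> \<open>Between squares the process is frozen at the last completed epoch, hence is
    known at the clock time \<open>?t k\<close>.\<close>
  let ?S = "\<lambda>k. mixture N g (floor_sqrt k)"
  have "supermartingale (seq_measure P) (\<lambda>k. nat_filtration M (enat (?t k))) ?S" if "P \<in> \<P>" for P
  proof -
    have P: "P \<in> space (prob_algebra M)" using \<P> that by blast
    interpret prob_space "seq_measure P" by (rule prob_space_iid[OF P])
    show ?thesis
    proof (rule supermartingaleI)
      show "finite_measure (seq_measure P)" by (rule finite_measure_axioms)
      show "subalgebra (nat_filtration M (enat (?t k))) (nat_filtration M (enat (?t j)))" if "j \<le> k" for j k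
        using that by (intro subalgebra_nat_filtration_mono) (simp add: mono_floor_sqrt' power_mono)
      show "(\<integral>\<omega>\<in>A. ?S k \<omega> \<partial>seq_measure P) \<le> (\<integral>\<omega>\<in>A. ?S j \<omega> \<partial>seq_measure P)"
        if "j \<le> k" "A \<in> sets (nat_filtration M (enat (?t j)))" for j k A
        by (rule mixture_set_integral_antimono[OF g_meas g_bound P g_P[OF \<open>P \<in> \<P>\<close>] that(2) mono_floor_sqrt'[OF that(1)]])
    qed (intro subalgebra_nat_filtration_iid[OF P] mixture_measurable[OF g_meas g_bound]
        mixture_integrable[OF g_meas g_bound P]; assumption)+
  qed
  moreover have "AE \<omega> in seq_measure Q. filterlim (\<lambda>k. ?S k \<omega>) at_top sequentially" if QQ: "Q \<in> \<Q>" for Q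
  proof -
    have Q: "Q \<in> space (prob_algebra M)" using \<Q> that by blast
    obtain m where m: "0 < (\<integral>x. h m x \<partial>pow_measure Q (n m))" using hQ[OF QQ] by blast
    define \<mu> where "\<mu> = (\<integral>x. u m x \<partial>pow_measure Q (n m))"
    have "0 < \<mu>" using m c(1)[of m] by (simp add: \<mu>_def u_def)
    \<comment> \<open>A stake below \<open>\<mu> / 2\<close> is what
      \<open>integral_inverse_less_one\<close> asks for. It depends on \<open>Q\<close>, but the
      mixture contains every stake.\<close>
    then obtain j where j: "inverse (real (Suc j)) < \<mu> / 2" using reals_Archimedean[of "\<mu> / 2"] by auto
    have "b j \<le> inverse (real (Suc j))" by (simp add: b_def field_simps)
    with j have bj: "2 * b j < \<mu>" by linarith
    define i where "i = prod_encode (m, j)"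
    have i: "N i = n m" "g i = (\<lambda>x. b j * u m x)" by (auto simp: i_def N_def g_def)
    have "(\<integral>\<^sup>+x. ennreal (inverse (1 + g i x)) \<partial>pow_measure Q (N i)) < 1"
      unfolding i
    proof (rule integral_inverse_less_one)
      show "u m \<in> borel_measurable (pow_measure Q (n m))" using u_meas[of m] measurable_iid[OF Q] by blast
      show "\<bar>u m x\<bar> \<le> 1" if "x \<in> space (pow_measure Q (n m))" for x
        using that by (intro u_bound) (simp only: sets_iid[OF Q])
    qed (use b bj in \<open>simp_all add: \<mu>_def prob_space_iid[OF Q]\<close>)
    from wealth_tendsto[OF g_meas g_bound Q this] show ?thesis
    proof (rule AE_mp, intro AE_I2 impI)
      fix \<omega> assume "\<omega> \<in> space (seq_measure Q)" and lim: "filterlim (\<lambda>r. wealth (N i) (g i) r \<omega>) at_top sequentially"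
      then have \<omega>: "\<omega> \<in> space (seq_measure M)" by (simp only: sets_iid[OF Q])
      have "filterlim (\<lambda>r. (1 / 2) ^ Suc i * wealth (N i) (g i) r \<omega>) at_top sequentially"
        by (rule filterlim_tendsto_pos_mult_at_top[OF tendsto_const _ lim]) simp
      then have "filterlim (\<lambda>r. mixture N g r \<omega>) at_top sequentially"
        by (rule filterlim_at_top_mono) (intro always_eventually allI mixture_ge[OF g_meas g_bound \<omega>])
      moreover have "filterlim floor_sqrt at_top sequentially"
        unfolding filterlim_at_top
      proof
        fix Z show "\<forall>\<^sub>F k in sequentially. Z \<le> floor_sqrt k"
          by (rule eventually_sequentiallyI[of "Z\<^sup>2"]) (rule le_floor_sqrtI)
      qed
      ultimately show "filterlim (\<lambda>k. ?S k \<omega>) at_top sequentially" by (rule filterlim_compose)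
    qed
  qed
  moreover have "mono ?t" by (intro monoI power_mono mono_floor_sqrt') auto
  moreover have "0 \<le> ?S k \<omega>" if "\<omega> \<in> space (seq_measure M)" for k \<omega>
    by (rule mixture_nonneg[OF g_meas g_bound that])
  moreover have "?S k \<in> borel_measurable (nat_filtration M (enat (?t k)))" for k
    by (rule mixture_measurable[OF g_meas g_bound])
  moreover have "?S 0 \<omega> = 1" for \<omega>
    by (simp add: mixture_0)
  ultimately show ?thesis
    using floor_sqrt_power2_asymp by (intro exI[of _ ?t] exI[of _ ?S]) simp
qed

section \<open>The equivalences\<close>

text \<open>A bound on \<open>h\<close> caps its expectations uniformly over the null, so the real
  supremum is a genuine upper bound.\<close>

lemma integral_le_SUP:
  assumes \<P>: "\<P> \<subseteq> space (prob_algebra M)" and h: "bounded_measurable (pow_measure M n) h"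
    and P: "P \<in> \<P>"
  shows "(\<integral>x. h x \<partial>pow_measure P n) \<le> (SUP P\<in>\<P>. \<integral>x. h x \<partial>pow_measure P n)"
proof -
  obtain c where c: "\<And>x. x \<in> space (pow_measure M n) \<Longrightarrow> norm (h x) \<le> c"
    using h unfolding bounded_measurable_def bounded_iff by blast
  have "(\<integral>x. h x \<partial>pow_measure R n) \<le> c" if "R \<in> \<P>" for R
  proof -
    have R: "R \<in> space (prob_algebra M)" using \<P> that by blast
    interpret prob_space "pow_measure R n" by (rule prob_space_iid[OF R])
    show ?thesis
    proof (intro integral_le_const integrable_bounded_iid[OF R h] AE_I2)
      fix x assume "x \<in> space (pow_measure R n)"
      then have "x \<in> space (pow_measure M n)" by (simp only: sets_iid[OF R])
      from c[OF this] show "h x \<le> c" by simp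
    qed
  qed
  then have "bdd_above ((\<lambda>P. \<integral>x. h x \<partial>pow_measure P n) ` \<P>)" by (intro bdd_aboveI2)
  then show ?thesis using P by (intro cSUP_upper)
qed

lemma bounded_measurable_unit_interval:
  assumes "\<phi> \<in> borel_measurable N" "\<forall>x\<in>space N. \<phi> x \<in> {0..1::real}"
  shows "bounded_measurable N \<phi>"
  using assms by (auto simp: bounded_measurable_def bounded_iff intro!: exI[of _ 1])

text \<open>From any member the chain runs to the last one, wraps around to the head and then runs
  on to any other.\<close>

lemma all_equivalent_cycleI:
  assumes "successively (\<longrightarrow>) ps" "last ps \<longrightarrow> hd ps"
  shows "all_equivalent ps"
proof -
  have imp: "ps ! i \<longrightarrow> ps ! j" if "i \<le> j" "j < length ps" for i j
    using that
  proof (induction j rule: dec_induct)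
    case (step k)
    then show ?case using assms(1) by (auto simp: successively_conv_nth)
  qed simp
  have "q" if "p \<in> set ps" "q \<in> set ps" "p" for p q
  proof -
    obtain i j where i: "i < length ps" "p = ps ! i" and j: "j < length ps" "q = ps ! j"
      using \<open>p \<in> set ps\<close> \<open>q \<in> set ps\<close> by (auto simp: in_set_conv_nth)
    then have ne: "ps \<noteq> []" by auto
    have "last ps" using imp[of i "length ps - 1"] i ne \<open>p\<close> by (auto simp: last_conv_nth)
    then have "ps ! 0" using assms(2) ne by (simp add: hd_conv_nth)
    then show q using imp[of 0 j] j by simp
  qed
  then show ?thesis unfolding all_equivalent_def by blast
qed

theorem theorem3p1:
  fixes M :: "'a measure" and \<P> \<Q> :: "'a measure set"
  assumes "\<P> \<subseteq> space (prob_algebra M)" "\<P> \<noteq> {}"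
    and "\<Q> \<subseteq> space (prob_algebra M)" "\<Q> \<noteq> {}"
  shows "all_equivalent
   [ \<comment> \<open>(i)\<close>
     \<exists>\<alpha>\<in>{0<..<1}. \<exists>\<tau>. sequential_test M \<tau> \<and> level \<alpha> \<P> \<tau> \<and> (\<forall>Q\<in>\<Q>. power_one Q \<tau>),
     \<comment> \<open>(ii)\<close>
     \<forall>\<alpha>\<in>{0<..<1}. \<exists>\<tau>. sequential_test M \<tau> \<and> level \<alpha> \<P> \<tau> \<and> (\<forall>Q\<in>\<Q>. power_one Q \<tau>),
     \<comment> \<open>(iii)\<close>
     \<exists>E. e_process M \<P> E \<and>
         (\<forall>Q\<in>\<Q>. AE \<omega> in seq_measure Q. (\<lambda>n. E n \<omega>) \<longlonglongrightarrow> \<infinity>),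
     \<comment> \<open>(iii')\<close>
     \<exists>E. e_process M \<P> E \<and>
         (\<forall>Q\<in>\<Q>. AE \<omega> in seq_measure Q. limsup (\<lambda>n. E n \<omega>) = \<infinity>),
     \<comment> \<open>(iv)\<close>
     \<exists>(n :: nat \<Rightarrow> nat) B.
         (\<forall>m. 1 \<le> n m \<and> B m \<in> sets (pow_measure M (n m))) \<and>
         (\<forall>Q\<in>\<Q>. \<exists>m. measure (pow_measure Q (n m)) (B m) >
                      (SUP P\<in>\<P>. measure (pow_measure P (n m)) (B m))),
     \<comment> \<open>(v)\<close>
     \<exists>(n :: nat \<Rightarrow> nat) \<phi>.
         (\<forall>m. 1 \<le> n m \<and> \<phi> m \<in> borel_measurable (pow_measure M (n m)) \<and>
              (\<forall>x\<in>space (pow_measure M (n m)). \<phi> m x \<in> {0..1::real})) \<and>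
         (\<forall>Q\<in>\<Q>. \<exists>m. (\<integral>x. \<phi> m x \<partial>pow_measure Q (n m)) >
                      (SUP P\<in>\<P>. \<integral>x. \<phi> m x \<partial>pow_measure P (n m))),
     \<comment> \<open>(v), equivalent form with rational thresholds\<close>
     \<exists>(n :: nat \<Rightarrow> nat) \<phi> (q :: nat \<Rightarrow> real).
         (\<forall>m. 1 \<le> n m \<and> \<phi> m \<in> borel_measurable (pow_measure M (n m)) \<and>
              (\<forall>x\<in>space (pow_measure M (n m)). \<phi> m x \<in> {0..1::real}) \<and>
              q m \<in> \<rat> \<inter> {0..1}) \<and>
         (\<forall>Q\<in>\<Q>. \<exists>m. (SUP P\<in>\<P>. \<integral>x. \<phi> m x \<partial>pow_measure P (n m)) \<le> q m \<and>
                      q m < (\<integral>x. \<phi> m x \<partial>pow_measure Q (n m))),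
     \<comment> \<open>(vi)\<close>
     \<exists>(n :: nat \<Rightarrow> nat) h.
         (\<forall>m. 1 \<le> n m \<and> bounded_measurable (pow_measure M (n m)) (h m)) \<and>
         (\<forall>m. (SUP P\<in>\<P>. \<integral>x. h m x \<partial>pow_measure P (n m)) \<le> 0) \<and>
         (\<forall>Q\<in>\<Q>. \<exists>m. (\<integral>x. h m x \<partial>pow_measure Q (n m)) > 0),
     \<comment> \<open>(vii)\<close>
     \<exists>F :: nat \<Rightarrow> 'a measure \<Rightarrow> real.
         (\<forall>m. \<exists>n\<ge>1. bounded_estimable M n (F m)) \<and>
         (\<forall>P\<in>\<P>. \<forall>m. F m P \<le> 0) \<and>
         (\<forall>Q\<in>\<Q>. \<exists>m. F m Q > 0),
     \<comment> \<open>(viii)\<close>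
     \<exists>(t :: nat \<Rightarrow> nat) (S :: nat \<Rightarrow> (nat \<Rightarrow> 'a) \<Rightarrow> real).
         t 0 = 0 \<and> mono t \<and> (\<forall>k. t k \<le> k) \<and> (\<lambda>k. real (t k) / real k) \<longlonglongrightarrow> 1 \<and>
         (\<forall>k. \<forall>\<omega>\<in>space (seq_measure M). 0 \<le> S k \<omega>) \<and>
         (\<forall>k. S k \<in> borel_measurable (nat_filtration M (enat (t k)))) \<and>
         (\<forall>\<omega>\<in>space (seq_measure M). S 0 \<omega> = 1) \<and>
         (\<forall>P\<in>\<P>. supermartingale (seq_measure P) (\<lambda>k. nat_filtration M (enat (t k))) S) \<and>
         (\<forall>Q\<in>\<Q>. AE \<omega> in seq_measure Q. filterlim (\<lambda>k. S k \<omega>) at_top sequentially)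
   ]"
proof -
  let "all_equivalent [?i, ?ii, ?iii, ?iii', ?iv, ?v, ?v', ?vi, ?vii, ?viii]" = ?thesis
  have i_iv: ?iv if ?i
  proof -
    from that obtain \<alpha> where \<alpha>: "\<alpha> \<in> {0<..<1}" "testable M \<P> \<Q> \<alpha>"
      unfolding testable_def[symmetric] by (rule bexE)
    from testable_imp_event_separation[OF assms(1-3) \<alpha>(2)] \<alpha>(1) show ?iv by simp
  qed
  have ii_i: ?i if ?ii
    using bspec[OF that, of "1 / 2"] by (intro bexI[of _ "1 / 2"]) simp_all
  have ii_iii: ?iii if ?ii
    using that unfolding testable_def[symmetric]
    by (intro testable_imp_e_process[OF assms(1,3)]) (rule bspec)
  have iii_iii': ?iii' if ?iii
  proof -
    from that obtain E where E: "e_process M \<P> E"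
      and lim: "\<forall>Q\<in>\<Q>. AE \<omega> in seq_measure Q. (\<lambda>n. E n \<omega>) \<longlonglongrightarrow> \<infinity>"
      by (elim exE conjE) blast
    have "AE \<omega> in seq_measure Q. limsup (\<lambda>n. E n \<omega>) = \<infinity>" if "Q \<in> \<Q>" for Q
      using bspec[OF lim that] by eventually_elim (intro lim_imp_Limsup trivial_limit_sequentially)
    with E show ?iii' by (intro exI[of _ E] conjI ballI)
  qed
  have iii'_ii: ?ii if ?iii'
  proof -
    from that obtain E where E: "e_process M \<P> E"
      and lim: "\<forall>Q\<in>\<Q>. AE \<omega> in seq_measure Q. limsup (\<lambda>n. E n \<omega>) = \<infinity>"
      by (elim exE conjE) blast
    show ?ii
      unfolding testable_def[symmetric]
      by (intro ballI e_process_imp_testable[OF assms(1-3) E]) (rule bspec[OF lim], assumption, simp)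
  qed
  have iv_v: ?v if ?iv
  proof -
    from that obtain n :: "nat \<Rightarrow> nat" and B where nB: "\<forall>m. 1 \<le> n m \<and> B m \<in> sets (pow_measure M (n m))"
      and sep: "\<forall>Q\<in>\<Q>. \<exists>m. measure (pow_measure Q (n m)) (B m) >
                      (SUP P\<in>\<P>. measure (pow_measure P (n m)) (B m))"
      by (elim exE conjE) blast
    from nB have B: "1 \<le> n m" "B m \<in> sets (pow_measure M (n m))" for m by blast+
    have eq: "(\<integral>x. indicat_real (B m) x \<partial>pow_measure R (n m)) = measure (pow_measure R (n m)) (B m)"
      if "R \<in> space (prob_algebra M)" for R m
    proof -
      have "B m \<in> sets (pow_measure R (n m))" using B(2) by (simp only: sets_iid[OF that])
      then show ?thesis using sets.sets_into_space[of "B m"] by (simp add: Int_absorb2)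
    qed
    show ?v
    proof (intro exI[of _ n] exI[of _ "\<lambda>m. indicator (B m)"] conjI allI ballI)
      fix Q assume "Q \<in> \<Q>"
      then have Q: "Q \<in> space (prob_algebra M)" using assms(3) by blast
      have "(SUP P\<in>\<P>. \<integral>x. indicat_real (B m) x \<partial>pow_measure P (n m))
          = (SUP P\<in>\<P>. measure (pow_measure P (n m)) (B m))" for m
        using assms(1) by (intro SUP_cong refl eq) blast
      then show "\<exists>m. (\<integral>x. indicat_real (B m) x \<partial>pow_measure Q (n m)) >
          (SUP P\<in>\<P>. \<integral>x. indicat_real (B m) x \<partial>pow_measure P (n m))"
        using bspec[OF sep \<open>Q \<in> \<Q>\<close>] by (simp only: eq[OF Q])
    qed (use B in \<open>auto simp: indicator_def\<close>)
  qed
  have v_v': ?v' if ?v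
  proof -
    from that obtain n :: "nat \<Rightarrow> nat" and \<phi> where n\<phi>: "\<forall>m. 1 \<le> n m \<and> \<phi> m \<in> borel_measurable (pow_measure M (n m)) \<and>
              (\<forall>x\<in>space (pow_measure M (n m)). \<phi> m x \<in> {0..1::real})"
      and sep: "\<forall>Q\<in>\<Q>. \<exists>m. (\<integral>x. \<phi> m x \<partial>pow_measure Q (n m)) >
                      (SUP P\<in>\<P>. \<integral>x. \<phi> m x \<partial>pow_measure P (n m))"
      by (elim exE conjE) blast
    from n\<phi> have n: "1 \<le> n m" and meas: "\<phi> m \<in> borel_measurable (pow_measure M (n m))"
      and \<phi>: "\<forall>x\<in>space (pow_measure M (n m)). \<phi> m x \<in> {0..1::real}" for m
      by blast+
    have range: "(\<integral>x. \<phi> m x \<partial>pow_measure R (n m)) \<in> {0..1}" if R: "R \<in> space (prob_algebra M)" for R m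
    proof -
      interpret prob_space "pow_measure R (n m)" by (rule prob_space_iid[OF R])
      have *: "\<phi> m x \<in> {0..1}" if "x \<in> space (pow_measure R (n m))" for x
        using \<phi>[of m] that by (simp only: sets_iid[OF R])
      show ?thesis
        using * integrable_bounded_iid[OF R bounded_measurable_unit_interval[OF meas \<phi>, of m]]
        by (auto intro!: integral_le_const AE_I2 Bochner_Integration.integral_nonneg)
    qed
    have "countable (\<rat> \<inter> {0..1} :: real set)" using countable_rat by (rule countable_Int1)
    moreover have "(0::real) \<in> \<rat> \<inter> {0..1}" by simp
    ultimately obtain r :: "nat \<Rightarrow> real" where r: "range r = \<rat> \<inter> {0..1}"
      by (metis range_from_nat_into empty_iff)
    \<comment> \<open>Pairing lets a single sequence offer each function together with each rational
      threshold in the unit interval.\<close>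
    let ?n = "\<lambda>k. n (fst (prod_decode k))" and ?\<phi> = "\<lambda>k. \<phi> (fst (prod_decode k))"
      and ?q = "\<lambda>k. r (snd (prod_decode k))"
    show ?v'
    proof (intro exI[of _ ?n] exI[of _ ?\<phi>] exI[of _ ?q] conjI allI)
      show "?q k \<in> \<rat> \<inter> {0..1}" for k using r by blast
      show "\<forall>Q\<in>\<Q>. \<exists>k. (SUP P\<in>\<P>. \<integral>x. ?\<phi> k x \<partial>pow_measure P (?n k)) \<le> ?q k \<and>
                      ?q k < (\<integral>x. ?\<phi> k x \<partial>pow_measure Q (?n k))"
      proof
        fix Q assume Q: "Q \<in> \<Q>"
        obtain m where m: "(SUP P\<in>\<P>. \<integral>x. \<phi> m x \<partial>pow_measure P (n m)) < (\<integral>x. \<phi> m x \<partial>pow_measure Q (n m))"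
          using bspec[OF sep Q] by blast
        then obtain s where s: "s \<in> \<rat>" "(SUP P\<in>\<P>. \<integral>x. \<phi> m x \<partial>pow_measure P (n m)) < s"
          "s < (\<integral>x. \<phi> m x \<partial>pow_measure Q (n m))" using Rats_dense_in_real by blast
        \<comment> \<open>A null law shows that the supremum, and with it \<open>s\<close>, is at
          least zero; the expectation under \<open>Q\<close> bounds \<open>s\<close> by one.\<close>
        obtain P where P: "P \<in> \<P>" using assms(2) by blast
        have "(\<integral>x. \<phi> m x \<partial>pow_measure P (n m)) \<le> (SUP P\<in>\<P>. \<integral>x. \<phi> m x \<partial>pow_measure P (n m))"
          by (rule integral_le_SUP[OF assms(1) bounded_measurable_unit_interval[OF meas \<phi>] P])
        then have "s \<in> {0..1}" using s range[of P m] range[of Q m] P Q assms(1,3) by fastforce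
        with s(1) r obtain j where "s = r j" by blast
        with s show "\<exists>k. (SUP P\<in>\<P>. \<integral>x. ?\<phi> k x \<partial>pow_measure P (?n k)) \<le> ?q k \<and>
                      ?q k < (\<integral>x. ?\<phi> k x \<partial>pow_measure Q (?n k))"
          by (intro exI[of _ "prod_encode (m, j)"]) simp
      qed
    qed (use n meas \<phi> in blast)+
  qed
  have v'_vi: ?vi if ?v'
  proof -
    from that obtain n :: "nat \<Rightarrow> nat" and \<phi> q where n\<phi>: "\<forall>m. 1 \<le> n m \<and> \<phi> m \<in> borel_measurable (pow_measure M (n m)) \<and>
              (\<forall>x\<in>space (pow_measure M (n m)). \<phi> m x \<in> {0..1::real}) \<and> q m \<in> \<rat> \<inter> {0..1::real}"
      and sep: "\<forall>Q\<in>\<Q>. \<exists>m. (SUP P\<in>\<P>. \<integral>x. \<phi> m x \<partial>pow_measure P (n m)) \<le> q m \<and>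
                      q m < (\<integral>x. \<phi> m x \<partial>pow_measure Q (n m))"
      by (elim exE conjE) blast
    from n\<phi> have n: "1 \<le> n m" and meas: "\<phi> m \<in> borel_measurable (pow_measure M (n m))"
      and \<phi>: "\<forall>x\<in>space (pow_measure M (n m)). \<phi> m x \<in> {0..1::real}" and q: "q m \<in> \<rat> \<inter> {0..1::real}" for m
      by blast+
    note bd = bounded_measurable_unit_interval[OF meas \<phi>]
    \<comment> \<open>The null bound is guaranteed only at an index serving some \<open>Q\<close>.
      Elsewhere \<open>\<phi> m - q m\<close> might have a positive null mean, so such entries are
      replaced by zero; no alternative loses its separating index.\<close>
    define h where "h m x = (if (SUP P\<in>\<P>. \<integral>x. \<phi> m x \<partial>pow_measure P (n m)) \<le> q m then \<phi> m x - q m else 0)" for m x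
    have h: "(\<integral>x. h m x \<partial>pow_measure R (n m)) =
        (if (SUP P\<in>\<P>. \<integral>x. \<phi> m x \<partial>pow_measure P (n m)) \<le> q m then (\<integral>x. \<phi> m x \<partial>pow_measure R (n m)) - q m else 0)"
      if R: "R \<in> space (prob_algebra M)" for R m
    proof -
      interpret prob_space "pow_measure R (n m)" by (rule prob_space_iid[OF R])
      show ?thesis unfolding h_def using integrable_bounded_iid[OF R bd, of m] prob_space by simp
    qed
    show ?vi
    proof (intro exI[of _ n] exI[of _ h] conjI allI ballI n)
      fix m
      show "bounded_measurable (pow_measure M (n m)) (h m)"
        unfolding bounded_measurable_def
      proof
        show "h m \<in> borel_measurable (pow_measure M (n m))"
          unfolding h_def[abs_def] using meas[of m] by simp
        have "\<bar>h m x\<bar> \<le> 1" if "x \<in> space (pow_measure M (n m))" for x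
          using bspec[OF \<phi> that] q[of m] by (simp add: h_def abs_le_iff)
        then show "bounded (h m ` space (pow_measure M (n m)))" by (auto simp: bounded_iff)
      qed
      show "(SUP P\<in>\<P>. \<integral>x. h m x \<partial>pow_measure P (n m)) \<le> 0"
      proof (rule cSUP_least[OF assms(2)])
        fix P assume P: "P \<in> \<P>"
        then have "P \<in> space (prob_algebra M)" using assms(1) by blast
        then show "(\<integral>x. h m x \<partial>pow_measure P (n m)) \<le> 0"
          using integral_le_SUP[OF assms(1) bd P, of m] by (simp add: h)
      qed
    next
      fix Q assume Q: "Q \<in> \<Q>"
      then have "Q \<in> space (prob_algebra M)" using assms(3) by blast
      then show "\<exists>m. 0 < (\<integral>x. h m x \<partial>pow_measure Q (n m))" using bspec[OF sep Q] by (auto simp: h)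
    qed
  qed
  have vi_vii: ?vii if ?vi
  proof -
    from that obtain n :: "nat \<Rightarrow> nat" and h where nh: "\<forall>m. 1 \<le> n m \<and> bounded_measurable (pow_measure M (n m)) (h m)"
      and le: "\<forall>m. (SUP P\<in>\<P>. \<integral>x. h m x \<partial>pow_measure P (n m)) \<le> 0"
      and sep: "\<forall>Q\<in>\<Q>. \<exists>m. (\<integral>x. h m x \<partial>pow_measure Q (n m)) > 0"
      by (elim exE conjE) blast
    from nh have n: "1 \<le> n m" and bd: "bounded_measurable (pow_measure M (n m)) (h m)" for m
      by blast+
    show ?vii
    proof (intro exI[of _ "\<lambda>m R. \<integral>x. h m x \<partial>pow_measure R (n m)"] conjI allI ballI)
      show "\<exists>k\<ge>1. bounded_estimable M k (\<lambda>R. \<integral>x. h m x \<partial>pow_measure R (n m))" for m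
        using n bounded_estimable_integral[OF bd] by blast
      show "(\<integral>x. h m x \<partial>pow_measure P (n m)) \<le> 0" if "P \<in> \<P>" for P m
        using integral_le_SUP[OF assms(1) bd that] spec[OF le] by (rule order_trans)
      show "\<exists>m. 0 < (\<integral>x. h m x \<partial>pow_measure Q (n m))" if "Q \<in> \<Q>" for Q using bspec[OF sep that] .
    qed
  qed
  have vii_viii: ?viii if ?vii
  proof -
    from that obtain F :: "nat \<Rightarrow> 'a measure \<Rightarrow> real" where est: "\<forall>m. \<exists>n\<ge>1. bounded_estimable M n (F m)"
      and FP: "\<forall>P\<in>\<P>. \<forall>m. F m P \<le> 0" and FQ: "\<forall>Q\<in>\<Q>. \<exists>m. F m Q > 0"
      by (elim exE conjE) blast
    have "\<forall>m. \<exists>n h. bounded_measurable (pow_measure M n) h \<and>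
        (\<forall>R\<in>space (prob_algebra M). F m R = (\<integral>x. h x \<partial>pow_measure R n))"
      using est unfolding bounded_estimable_def by blast
    then obtain n h where bd: "\<And>m. bounded_measurable (pow_measure M (n m)) (h m)"
      and F: "\<And>m R. R \<in> space (prob_algebra M) \<Longrightarrow> F m R = (\<integral>x. h m x \<partial>pow_measure R (n m))"
      by metis
    show ?viii
    proof (rule separation_imp_supermartingale[OF assms(1,3) bd])
      show "(\<integral>x. h m x \<partial>pow_measure P (n m)) \<le> 0" if "P \<in> \<P>" for m P
        using bspec[OF FP that] F[OF subsetD[OF assms(1) that]] by simp
      show "\<exists>m. 0 < (\<integral>x. h m x \<partial>pow_measure Q (n m))" if "Q \<in> \<Q>" for Q
        using bspec[OF FQ that] F[OF subsetD[OF assms(3) that]] by simp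
    qed
  qed
  have viii_ii: ?ii if ?viii
  proof -
    from that obtain t :: "nat \<Rightarrow> nat" and S :: "nat \<Rightarrow> (nat \<Rightarrow> 'a) \<Rightarrow> real" where
      nn: "\<forall>k. \<forall>\<omega>\<in>space (seq_measure M). 0 \<le> S k \<omega>"
      and ms: "\<forall>k. S k \<in> borel_measurable (nat_filtration M (enat (t k)))"
      and S0: "\<forall>\<omega>\<in>space (seq_measure M). S 0 \<omega> = 1"
      and sm: "\<forall>P\<in>\<P>. supermartingale (seq_measure P) (\<lambda>k. nat_filtration M (enat (t k))) S"
      and lim: "\<forall>Q\<in>\<Q>. AE \<omega> in seq_measure Q. filterlim (\<lambda>k. S k \<omega>) at_top sequentially"
      by (elim exE conjE) blast
    show ?ii
      unfolding testable_def[symmetric]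
    proof
      fix \<alpha> :: real assume "\<alpha> \<in> {0<..<1}"
      then have "0 < \<alpha>" by simp
      show "testable M \<P> \<Q> \<alpha>"
        by (rule supermartingale_imp_testable[where S=S and t=t, OF assms(1-3) spec[OF ms]])
          (use nn S0 sm lim \<open>0 < \<alpha>\<close> in blast)+
    qed
  qed
  let ?ps = "[?i, ?ii, ?iii, ?iii', ?iv, ?v, ?v', ?vi, ?vii, ?viii]"
  \<comment> \<open>The list order calls for implications not proved directly: (i) reaches (ii)
    through (iv) to (viii), (iii') reaches (iv) through (ii) and (i), and (viii) closes the cycle
    through (ii).\<close>
  have i_ii: ?ii if ?i
    using that by (rule viii_ii[OF vii_viii[OF vi_vii[OF v'_vi[OF v_v'[OF iv_v[OF i_iv]]]]]])
  have iii'_iv: ?iv if ?iii'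
    using that by (rule i_iv[OF ii_i[OF iii'_ii]])
  have viii_i: ?i if ?viii
    using that by (rule ii_i[OF viii_ii])
  show ?thesis
  proof (rule all_equivalent_cycleI)
    show "successively (\<longrightarrow>) ?ps"
      unfolding successively.simps
      by (intro conjI TrueI impI) (erule i_ii ii_iii iii_iii' iii'_iv iv_v v_v' v'_vi vi_vii vii_viii)+
    have "?viii \<longrightarrow> ?i" by (rule impI) (rule viii_i)
    then show "last ?ps \<longrightarrow> hd ?ps"
      by (simp only: last.simps list.sel list.distinct if_False if_True refl)
  qed
qed

end
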